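(* There exist absolute constants $c>0$ and $d_0$ such that for all $d\ge d_0$, all $\kappa$ with $10\le\kappa\le d^4$, and every step size $h>0$, there exist a twice-differentiable $f:\mathbb{R}^d\to\mathbb{R}$ with $I\preceq\nabla^2 f(x)\preceq\kappa I$ for all $x$, and a probability distribution $\pi_0$ with $\frac{d\pi_0}{d\pi}(x)\le e^{d}$ for all $x$ (where $\pi\propto e^{-f}$), such that for every $T\le c\,\kappa d/\log^2 d$, the law $\pi_T$ of the MALA chain with step size $h$ after $T$ iterations started from $x_0\sim\pi_0$ satisfies $\|\pi_T-\pi\|_{\mathrm{TV}}>1/e$.
   Context: For $f:\mathbb{R}^d\to\mathbb{R}$ differentiable with $\int e^{-f}<\infty$, let $\pi$ denote the probability measure with density proportional to $e^{-f}$. The MALA Markov chain with step size $h>0$: from $x$, propose $y=x-h\nabla f(x)+\sqrt{2h}\,g$ with $g\sim\mathcal N(0,I_d)$; move to $y$ with probability $\min\{1,\exp(f(x)-f(y)+\frac{1}{4h}(\|y-x+h\nabla f(x)\|_2^2-\|x-y+h\nabla f(y)\|_2^2))\}$, otherwise stay at $x$. $\|\mu-\nu\|_{\mathrm{TV}}=\sup_A|\mu(A)-\nu(A)|$. *)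

theory Defs
  imports "HOL-Probability.Probability"
begin

text \<open>Points of R^d are represented as extensional functions nat => real
  supported on the index set {..<d}; this is exactly the carrier of the
  product measure PiM {..<d} (lambda _. lborel), i.e. Lebesgue measure on R^d.\<close>

definition Rd :: "nat \<Rightarrow> (nat \<Rightarrow> real) set" where
  "Rd d = PiE {..<d} (\<lambda>_. UNIV)"

definition lebd :: "nat \<Rightarrow> (nat \<Rightarrow> real) measure" where
  "lebd d = PiM {..<d} (\<lambda>_. lborel)"

definition gaussd :: "nat \<Rightarrow> (nat \<Rightarrow> real) measure" where
  "gaussd d = PiM {..<d} (\<lambda>_. density lborel std_normal_density)"

definition vadd :: "nat \<Rightarrow> (nat \<Rightarrow> real) \<Rightarrow> (nat \<Rightarrow> real) \<Rightarrow> (nat \<Rightarrow> real)" where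
  "vadd d x y = (\<lambda>i\<in>{..<d}. x i + y i)"

definition vsub :: "nat \<Rightarrow> (nat \<Rightarrow> real) \<Rightarrow> (nat \<Rightarrow> real) \<Rightarrow> (nat \<Rightarrow> real)" where
  "vsub d x y = (\<lambda>i\<in>{..<d}. x i - y i)"

definition ip :: "nat \<Rightarrow> (nat \<Rightarrow> real) \<Rightarrow> (nat \<Rightarrow> real) \<Rightarrow> real" where
  "ip d x y = (\<Sum>i<d. x i * y i)"

definition vnorm :: "nat \<Rightarrow> (nat \<Rightarrow> real) \<Rightarrow> real" where
  "vnorm d x = sqrt (ip d x x)"

definition matvec :: "nat \<Rightarrow> (nat \<Rightarrow> nat \<Rightarrow> real) \<Rightarrow> (nat \<Rightarrow> real) \<Rightarrow> (nat \<Rightarrow> real)" where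
  "matvec d A v = (\<lambda>i\<in>{..<d}. \<Sum>j<d. A i j * v j)"

definition has_gradient :: "nat \<Rightarrow> ((nat \<Rightarrow> real) \<Rightarrow> real) \<Rightarrow> ((nat \<Rightarrow> real) \<Rightarrow> (nat \<Rightarrow> real)) \<Rightarrow> bool" where
  "has_gradient d f G \<longleftrightarrow> (\<forall>x\<in>Rd d. G x \<in> Rd d \<and>
     (\<forall>e>0. \<exists>\<delta>>0. \<forall>v\<in>Rd d. vnorm d v < \<delta> \<longrightarrow>
        \<bar>f (vadd d x v) - f x - ip d (G x) v\<bar> \<le> e * vnorm d v))"

definition has_hessian :: "nat \<Rightarrow> ((nat \<Rightarrow> real) \<Rightarrow> (nat \<Rightarrow> real)) \<Rightarrow> ((nat \<Rightarrow> real) \<Rightarrow> nat \<Rightarrow> nat \<Rightarrow> real) \<Rightarrow> bool" where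
  "has_hessian d G H \<longleftrightarrow> (\<forall>x\<in>Rd d.
     (\<forall>e>0. \<exists>\<delta>>0. \<forall>v\<in>Rd d. vnorm d v < \<delta> \<longrightarrow>
        vnorm d (vsub d (vsub d (G (vadd d x v)) (G x)) (matvec d (H x) v)) \<le> e * vnorm d v))"

definition gibbs :: "nat \<Rightarrow> ((nat \<Rightarrow> real) \<Rightarrow> real) \<Rightarrow> (nat \<Rightarrow> real) measure" where
  "gibbs d f = density (lebd d)
     (\<lambda>x. ennreal (exp (- f x)) / (\<integral>\<^sup>+y. ennreal (exp (- f y)) \<partial>lebd d))"

definition mala_prop :: "nat \<Rightarrow> ((nat \<Rightarrow> real) \<Rightarrow> (nat \<Rightarrow> real)) \<Rightarrow> real \<Rightarrow> (nat \<Rightarrow> real) \<Rightarrow> (nat \<Rightarrow> real) \<Rightarrow> (nat \<Rightarrow> real)" where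
  "mala_prop d G h x g = (\<lambda>i\<in>{..<d}. x i - h * G x i + sqrt (2 * h) * g i)"

definition mala_acc :: "nat \<Rightarrow> ((nat \<Rightarrow> real) \<Rightarrow> real) \<Rightarrow> ((nat \<Rightarrow> real) \<Rightarrow> (nat \<Rightarrow> real)) \<Rightarrow> real \<Rightarrow> (nat \<Rightarrow> real) \<Rightarrow> (nat \<Rightarrow> real) \<Rightarrow> real" where
  "mala_acc d f G h x y = min 1 (exp (f x - f y + (1 / (4 * h)) *
      ((vnorm d (\<lambda>i\<in>{..<d}. y i - x i + h * G x i))\<^sup>2
       - (vnorm d (\<lambda>i\<in>{..<d}. x i - y i + h * G y i))\<^sup>2)))"

definition mala_kernel :: "nat \<Rightarrow> ((nat \<Rightarrow> real) \<Rightarrow> real) \<Rightarrow> ((nat \<Rightarrow> real) \<Rightarrow> (nat \<Rightarrow> real)) \<Rightarrow> real \<Rightarrow> (nat \<Rightarrow> real) \<Rightarrow> (nat \<Rightarrow> real) measure" where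
  "mala_kernel d f G h x = measure_of (space (lebd d)) (sets (lebd d))
     (\<lambda>A. \<integral>\<^sup>+g. (ennreal (mala_acc d f G h x (mala_prop d G h x g)) * indicator A (mala_prop d G h x g)
               + ennreal (1 - mala_acc d f G h x (mala_prop d G h x g)) * indicator A x) \<partial>gaussd d)"

fun mala_law :: "nat \<Rightarrow> ((nat \<Rightarrow> real) \<Rightarrow> real) \<Rightarrow> ((nat \<Rightarrow> real) \<Rightarrow> (nat \<Rightarrow> real)) \<Rightarrow> real \<Rightarrow> (nat \<Rightarrow> real) measure \<Rightarrow> nat \<Rightarrow> (nat \<Rightarrow> real) measure" where
  "mala_law d f G h mu0 0 = mu0"
| "mala_law d f G h mu0 (Suc n) = measure_of (space (lebd d)) (sets (lebd d))
     (\<lambda>A. \<integral>\<^sup>+x. emeasure (mala_kernel d f G h x) A \<partial>(mala_law d f G h mu0 n))"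

definition tv_dist :: "'a measure \<Rightarrow> 'a measure \<Rightarrow> real" where
  "tv_dist M N = (SUP A\<in>sets M. \<bar>measure M A - measure N A\<bar>)"

end

theory Submission
  imports Defs "HOL-Real_Asymp.Real_Asymp"
begin

text \<open>The potential is separable: coordinate 0 is \<open>x\<^sup>2 / 2\<close>, and every other coordinate is a quadratic of
  curvature \<open>\<kappa> / 2\<close> perturbed by a cosine oscillating at the scale \<open>sqrt h\<close> of one proposal. The start
  confines coordinate 0 to a short interval and reweights the other coordinates by \<open>1 + cos (x / sqrt h)\<close>;
  in both regimes of \<open>h\<close> the chain fails to spread coordinate 0.

  For small \<open>h\<close>, coordinate 0 satisfies \<open>E x\<^sub>0\<^sup>2 \<le> x\<^sub>0\<^sup>2 + 2 h\<close> in one step, so it needs about \<open>1 / h\<close> steps.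
  For larger \<open>h\<close> the chain is unlikely to move at all. By detailed balance, the probability that the first
  proposal from the start \<open>r d\<pi>\<close> is accepted is at most the mean of \<open>r\<close> after one unadjusted Langevin step
  from \<open>\<pi>\<close>, which factorises over coordinates. Gaussian cosine integrals show that each oscillating factor
  is at most \<open>1 - \<beta> / 80\<close> with \<open>\<beta> = min (\<kappa> h / 3) (1 / 100)\<close>: the potential makes \<open>cos (x / sqrt h)\<close>
  positively biased under \<open>\<pi>\<close>, and the Langevin step shrinks that bias by a factor close to \<open>1 / e\<close>.
  A chain that has rejected everything is still at its start, so a union bound over the steps concludes.\<close>

section \<open>Separable functions and product densities\<close>

text \<open>Since \<open>h\<close> is fixed before \<open>f\<close>, the potential can be tuned to
  the proposal: in the phase \<open>x / sqrt h\<close> the noise is \<open>sqrt 2 * g\<close>, so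
  averaging over it damps a cosine by exactly \<open>exp (-1)\<close>. With this start a purely
  quadratic target would not do: for small \<alpha> = \<kappa> h / 2 the stationary mean of the
  cosine, \<open>exp (- 1 / (2 * \<alpha>))\<close>, is far smaller than \<alpha>, and so is the
  loss per coordinate. The cosine in \<open>f\<close> creates a bias of first order in \<beta>,
  hence a loss linear in \<kappa> h until it saturates. The warmth budget e^d pays for the
  reweighting: a factor 2 per coordinate and a constant for coordinate 0 fit because 2 < e. The two
  regimes meet at h = ln^2 d / (\<kappa> d). Below it, the total time T h stays under a small
  constant. Above it, the mean acceptance probability is at most a constant times exp (- const *
  ln^2 d), smaller than every power of d, while \<kappa> \<le> d^4 keeps the number of steps below
  d^5.\<close>

lemma vnorm_power2: "(vnorm d x)\<^sup>2 = (\<Sum>i<d. (x i)\<^sup>2)"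
  by (simp add: vnorm_def ip_def power2_eq_square sum_nonneg)

lemma vnorm_nonneg: "0 \<le> vnorm d x"
  by (simp add: vnorm_def ip_def sum_nonneg)

lemma vnorm_le_sum_abs: "vnorm d x \<le> (\<Sum>i<d. \<bar>x i\<bar>)"
proof -
  have "vnorm d x = L2_set x {..<d}"
    by (simp add: vnorm_def ip_def L2_set_def power2_eq_square)
  then show ?thesis using L2_set_le_sum_abs[of x "{..<d}"] by simp
qed

text \<open>The mean value theorem alone gives this, with \<open>L\<close> in place of the sharp
  \<open>L / 2\<close>. Asking only for a Lipschitz derivative lets the same bound serve the
  gradient, the Hessian and the expansion of a shifted cosine.\<close>

lemma quadratic_remainder:
  fixes g g' :: "real \<Rightarrow> real"
  assumes deriv: "\<And>x. (g has_real_derivative g' x) (at x)"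
    and lip: "\<And>x y. \<bar>g' x - g' y\<bar> \<le> L * \<bar>x - y\<bar>"
  shows "\<bar>g (x + v) - g x - g' x * v\<bar> \<le> L * v\<^sup>2"
proof (cases "v = 0")
  case False
  obtain z where z: "\<bar>z - x\<bar> \<le> \<bar>v\<bar>" "g (x + v) - g x = v * g' z"
  proof (cases "v > 0")
    case True
    with MVT2[of x "x + v" g g'] deriv obtain z where "x < z" "z < x + v" "g (x+v) - g x = v * g' z"
      by auto
    with that[of z] show ?thesis by auto
  next
    case v: False
    with False MVT2[of "x + v" x g g'] deriv obtain z where "x + v < z" "z < x" "g x - g (x+v) = - v * g' z"
      by auto
    with that[of z] show ?thesis by auto
  qed
  have L: "0 \<le> L" using lip[of 1 0] by auto
  have "\<bar>g (x + v) - g x - g' x * v\<bar> = \<bar>g' z - g' x\<bar> * \<bar>v\<bar>"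
    unfolding z(2) abs_mult[symmetric] by (simp add: algebra_simps)
  also have "\<dots> \<le> (L * \<bar>z - x\<bar>) * \<bar>v\<bar>"
    by (intro mult_right_mono lip) auto
  also have "\<dots> \<le> (L * \<bar>v\<bar>) * \<bar>v\<bar>"
    by (intro mult_right_mono mult_left_mono z L) auto
  finally show ?thesis by (simp add: power2_eq_square mult.assoc)
qed simp

lemma quadratic_imp_first_order:
  assumes "\<And>v. v \<in> Rd d \<Longrightarrow> F v \<le> L * (vnorm d v)\<^sup>2" and "(e::real) > 0" and "L \<ge> 0"
  shows "\<exists>\<delta>>0. \<forall>v\<in>Rd d. vnorm d v < \<delta> \<longrightarrow> F v \<le> e * vnorm d v"
\<comment> \<open>The summand 1 keeps the denominator positive when \<open>L = 0\<close>.\<close>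
proof (intro exI[of _ "e / (L + 1)"] conjI ballI impI)
  show "0 < e / (L + 1)" using assms by simp
  fix v assume v: "v \<in> Rd d" "vnorm d v < e / (L + 1)"
  have "vnorm d v * L \<le> vnorm d v * (L + 1)"
    by (intro mult_left_mono) (auto simp: vnorm_nonneg)
  also have "\<dots> \<le> e" using v assms(3) by (simp add: pos_less_divide_eq)
  finally have "L * vnorm d v * vnorm d v \<le> e * vnorm d v"
    by (intro mult_right_mono vnorm_nonneg) (simp add: mult.commute)
  with assms(1)[OF v(1)] show "F v \<le> e * vnorm d v"
    by (simp add: power2_eq_square mult.assoc)
qed

lemma has_gradient_separable:
  fixes \<phi> \<phi>' :: "nat \<Rightarrow> real \<Rightarrow> real"
  assumes deriv: "\<And>i x. i < d \<Longrightarrow> (\<phi> i has_real_derivative \<phi>' i x) (at x)"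
    and lip: "\<And>i x y. i < d \<Longrightarrow> \<bar>\<phi>' i x - \<phi>' i y\<bar> \<le> L * \<bar>x - y\<bar>" and L: "L \<ge> 0"
  shows "has_gradient d (\<lambda>x. \<Sum>i<d. \<phi> i (x i)) (\<lambda>x. \<lambda>i\<in>{..<d}. \<phi>' i (x i))"
  unfolding has_gradient_def
proof (intro ballI conjI allI impI)
  fix x :: "nat \<Rightarrow> real"
  show "(\<lambda>i\<in>{..<d}. \<phi>' i (x i)) \<in> Rd d" by (simp add: Rd_def)
  fix e :: real assume e: "e > 0"
  show "\<exists>\<delta>>0. \<forall>v\<in>Rd d. vnorm d v < \<delta> \<longrightarrow>
    \<bar>(\<Sum>i<d. \<phi> i (vadd d x v i)) - (\<Sum>i<d. \<phi> i (x i)) - ip d (\<lambda>i\<in>{..<d}. \<phi>' i (x i)) v\<bar> \<le> e * vnorm d v"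
  proof (rule quadratic_imp_first_order[OF _ e L])
    fix v
    have "\<bar>(\<Sum>i<d. \<phi> i (vadd d x v i)) - (\<Sum>i<d. \<phi> i (x i)) - ip d (\<lambda>i\<in>{..<d}. \<phi>' i (x i)) v\<bar>
        = \<bar>\<Sum>i<d. \<phi> i (x i + v i) - \<phi> i (x i) - \<phi>' i (x i) * v i\<bar>"
      by (simp add: vadd_def ip_def sum_subtractf)
    also have "\<dots> \<le> (\<Sum>i<d. L * (v i)\<^sup>2)"
      by (intro order.trans[OF sum_abs] sum_mono quadratic_remainder deriv lip) auto
    finally show "\<bar>(\<Sum>i<d. \<phi> i (vadd d x v i)) - (\<Sum>i<d. \<phi> i (x i)) - ip d (\<lambda>i\<in>{..<d}. \<phi>' i (x i)) v\<bar>
        \<le> L * (vnorm d v)\<^sup>2"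
      by (simp add: vnorm_power2 sum_distrib_left)
  qed
qed

definition diag_mat :: "(nat \<Rightarrow> real) \<Rightarrow> nat \<Rightarrow> nat \<Rightarrow> real" where
  "diag_mat a = (\<lambda>i j. if i = j then a i else 0)"

lemma matvec_diag: "matvec d (diag_mat a) v = (\<lambda>i\<in>{..<d}. a i * v i)"
proof -
  have "(\<Sum>j<d. diag_mat a i j * v j) = a i * v i" if "i < d" for i
  proof -
    have "(\<Sum>j<d. diag_mat a i j * v j) = (\<Sum>j<d. if j = i then a i * v i else 0)"
      by (intro sum.cong) (auto simp: diag_mat_def)
    then show ?thesis using that by simp
  qed
  then show ?thesis by (auto simp: matvec_def)
qed

lemma has_hessian_separable:
  fixes \<phi>' \<phi>'' :: "nat \<Rightarrow> real \<Rightarrow> real"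
  assumes deriv: "\<And>i x. i < d \<Longrightarrow> (\<phi>' i has_real_derivative \<phi>'' i x) (at x)"
    and lip: "\<And>i x y. i < d \<Longrightarrow> \<bar>\<phi>'' i x - \<phi>'' i y\<bar> \<le> L * \<bar>x - y\<bar>" and L: "L \<ge> 0"
  shows "has_hessian d (\<lambda>x. \<lambda>i\<in>{..<d}. \<phi>' i (x i)) (\<lambda>x. diag_mat (\<lambda>i. \<phi>'' i (x i)))"
  unfolding has_hessian_def
proof (intro ballI allI impI)
  fix x :: "nat \<Rightarrow> real" and e :: real assume e: "e > 0"
  let ?R = "\<lambda>v. vsub d (vsub d (\<lambda>i\<in>{..<d}. \<phi>' i (vadd d x v i)) (\<lambda>i\<in>{..<d}. \<phi>' i (x i)))
              (matvec d (diag_mat (\<lambda>i. \<phi>'' i (x i))) v)"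
  show "\<exists>\<delta>>0. \<forall>v\<in>Rd d. vnorm d v < \<delta> \<longrightarrow> vnorm d (?R v) \<le> e * vnorm d v"
  proof (rule quadratic_imp_first_order[OF _ e L])
    fix v
    \<comment> \<open>Bounding the Euclidean norm by the sum of absolute values lets the
      coordinatewise quadratic remainders add up directly to
      \<open>L * (vnorm d v)\<^sup>2\<close>.\<close>
    have "vnorm d (?R v) \<le> (\<Sum>i<d. \<bar>?R v i\<bar>)" by (rule vnorm_le_sum_abs)
    also have "\<dots> = (\<Sum>i<d. \<bar>\<phi>' i (x i + v i) - \<phi>' i (x i) - \<phi>'' i (x i) * v i\<bar>)"
      by (intro sum.cong) (auto simp: vsub_def vadd_def matvec_diag)
    also have "\<dots> \<le> (\<Sum>i<d. L * (v i)\<^sup>2)"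
      by (intro sum_mono quadratic_remainder deriv lip) auto
    finally show "vnorm d (?R v) \<le> L * (vnorm d v)\<^sup>2"
      by (simp add: vnorm_power2 sum_distrib_left)
  qed
qed

lemma diag_quadratic_form_bounds:
  assumes "\<And>i. i < d \<Longrightarrow> lo \<le> a i" "\<And>i. i < d \<Longrightarrow> a i \<le> hi"
  shows "lo * ip d v v \<le> ip d v (matvec d (diag_mat a) v)"
    and "ip d v (matvec d (diag_mat a) v) \<le> hi * ip d v v"
proof -
  have eq: "ip d v (matvec d (diag_mat a) v) = (\<Sum>i<d. a i * (v i * v i))"
    unfolding matvec_diag by (simp add: ip_def mult_ac)
  show "lo * ip d v v \<le> ip d v (matvec d (diag_mat a) v)"
    unfolding eq unfolding ip_def sum_distrib_left by (intro sum_mono) (auto simp: assms intro!: mult_right_mono)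
  show "ip d v (matvec d (diag_mat a) v) \<le> hi * ip d v v"
    unfolding eq unfolding ip_def sum_distrib_left by (intro sum_mono) (auto simp: assms intro!: mult_right_mono)
qed

text \<open>Target and start are given by densities on the product space; reading them as product
  measures reduces total mass and the law of coordinate 0 to one-dimensional integrals. Both sides
  are compared on boxes, where the density factorises.\<close>

lemma density_PiM:
  fixes M :: "'i \<Rightarrow> 'a measure" and w :: "'i \<Rightarrow> 'a \<Rightarrow> ennreal"
  assumes I: "finite I" and M: "\<And>i. sigma_finite_measure (M i)"
    and w [measurable]: "\<And>i. w i \<in> borel_measurable (M i)"
    and dens: "\<And>i. sigma_finite_measure (density (M i) (w i))"
  shows "density (PiM I M) (\<lambda>x. \<Prod>i\<in>I. w i (x i)) = PiM I (\<lambda>i. density (M i) (w i))"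
proof -
  interpret M: product_sigma_finite M by (rule product_sigma_finite.intro) (rule M)
  interpret D: product_sigma_finite "\<lambda>i. density (M i) (w i)"
    by (rule product_sigma_finite.intro) (rule dens)
  show ?thesis
  proof (rule D.PiM_eqI[OF I])
    show "sets (density (PiM I M) (\<lambda>x. \<Prod>i\<in>I. w i (x i))) = sets (PiM I (\<lambda>i. density (M i) (w i)))"
      by (simp cong: sets_PiM_cong)
    fix A assume "\<And>i. i \<in> I \<Longrightarrow> A i \<in> sets (density (M i) (w i))"
    then have A [measurable]: "\<And>i. i \<in> I \<Longrightarrow> A i \<in> sets (M i)" by simp
    have [measurable]: "Pi\<^sub>E I A \<in> sets (PiM I M)" using I by (intro sets_PiM_I_finite A)
    have "emeasure (density (PiM I M) (\<lambda>x. \<Prod>i\<in>I. w i (x i))) (Pi\<^sub>E I A)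
        = (\<integral>\<^sup>+x. (\<Prod>i\<in>I. w i (x i)) * indicator (Pi\<^sub>E I A) x \<partial>PiM I M)"
      by (intro emeasure_density) (use I in measurable)
    also have "\<dots> = (\<integral>\<^sup>+x. (\<Prod>i\<in>I. w i (x i) * indicator (A i) (x i)) \<partial>PiM I M)"
    proof (intro nn_integral_cong)
      fix x assume x: "x \<in> space (PiM I M)"
      have "indicator (Pi\<^sub>E I A) x = (\<Prod>i\<in>I. indicator (A i) (x i) :: ennreal)"
        using x I by (auto simp: indicator_def PiE_iff space_PiM prod.neutral)
      then show "(\<Prod>i\<in>I. w i (x i)) * indicator (Pi\<^sub>E I A) x = (\<Prod>i\<in>I. w i (x i) * indicator (A i) (x i))"
        by (simp add: prod.distrib)
    qed
    also have "\<dots> = (\<Prod>i\<in>I. \<integral>\<^sup>+x. w i x * indicator (A i) x \<partial>M i)"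
      by (rule M.product_nn_integral_prod[OF I]) measurable
    also have "\<dots> = (\<Prod>i\<in>I. emeasure (density (M i) (w i)) (A i))"
      by (intro prod.cong refl) (simp add: emeasure_density)
    finally show "emeasure (density (PiM I M) (\<lambda>x. \<Prod>i\<in>I. w i (x i))) (Pi\<^sub>E I A)
        = (\<Prod>i\<in>I. emeasure (density (M i) (w i)) (A i))" .
  qed
qed

section \<open>The MALA kernel and its iterates\<close>

lemma prob_space_std_normal: "prob_space std_normal_distribution"
  using real_dist_normal_dist by (rule real_distribution.axioms)

lemma prob_space_gaussd: "prob_space (gaussd d)"
  unfolding gaussd_def by (intro prob_space_PiM prob_space_std_normal)

lemma space_lebd: "space (lebd d) = Rd d"
  by (simp add: lebd_def Rd_def space_PiM)

lemma sets_gaussd [measurable_cong]: "sets (gaussd d) = sets (lebd d)"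
  unfolding gaussd_def lebd_def by (intro sets_PiM_cong) auto

lemma measurable_lebd_component: "(\<lambda>x. x i) \<in> borel_measurable (lebd d)" if "i < d"
proof -
  have "(\<lambda>x. x i) \<in> measurable (lebd d) lborel"
    unfolding lebd_def by (rule measurable_component_singleton) (use that in auto)
  then show ?thesis by simp
qed

lemma measurable_into_lebd:
  assumes "\<And>i. i < d \<Longrightarrow> (\<lambda>z. F z i) \<in> borel_measurable M"
  shows "(\<lambda>z. \<lambda>i\<in>{..<d}. F z i) \<in> measurable M (lebd d)"
  unfolding lebd_def by (rule measurable_restrict) (use assms in auto)

text \<open>The kernel is defined by its values on sets only. Induction over simple functions and
  monotone limits carries the mixture formula over to integrals; arbitrary weights \<open>u\<close>
  and \<open>v\<close> keep the acceptance rule out of the induction.\<close>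

lemma nn_integral_eq_if_emeasure_mixture:
  assumes sets: "sets K = sets N"
    and Y [measurable]: "Y \<in> measurable M N" and z: "z \<in> space N"
    and u [measurable]: "u \<in> borel_measurable M" and v [measurable]: "v \<in> borel_measurable M"
    and em: "\<And>A. A \<in> sets N \<Longrightarrow> emeasure K A = (\<integral>\<^sup>+g. u g * indicator A (Y g) + v g * indicator A z \<partial>M)"
    and \<psi>: "\<psi> \<in> borel_measurable N"
  shows "(\<integral>\<^sup>+y. \<psi> y \<partial>K) = (\<integral>\<^sup>+g. u g * \<psi> (Y g) + v g * \<psi> z \<partial>M)"
  using \<psi>
proof (induction rule: borel_measurable_induct)
  case (cong p q)
  have "(\<integral>\<^sup>+y. p y \<partial>K) = (\<integral>\<^sup>+y. q y \<partial>K)"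
    by (intro nn_integral_cong) (use cong sets_eq_imp_space_eq[OF sets] in auto)
  moreover have "(\<integral>\<^sup>+g. u g * p (Y g) + v g * p z \<partial>M) = (\<integral>\<^sup>+g. u g * q (Y g) + v g * q z \<partial>M)"
    by (intro nn_integral_cong) (use cong z measurable_space[OF Y] in auto)
  ultimately show ?case using cong by simp
next
  case (set A)
  then show ?case using em[of A] sets by simp
next
  case (mult p c)
  note [measurable] = mult(2)
  have pK: "p \<in> borel_measurable K" using mult(2) measurable_cong_sets[OF sets refl] by blast
  have "(\<integral>\<^sup>+y. c * p y \<partial>K) = c * (\<integral>\<^sup>+g. u g * p (Y g) + v g * p z \<partial>M)"
    using mult pK by (simp add: nn_integral_cmult)
  also have "\<dots> = (\<integral>\<^sup>+g. c * (u g * p (Y g) + v g * p z) \<partial>M)"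
    by (rule nn_integral_cmult[symmetric]) measurable
  finally show ?case by (simp add: algebra_simps)
next
  case (add p q)
  note [measurable] = add(1,3)
  have pK: "p \<in> borel_measurable K" "q \<in> borel_measurable K"
    using add(1,3) measurable_cong_sets[OF sets refl] by blast+
  have "(\<integral>\<^sup>+y. q y + p y \<partial>K) = (\<integral>\<^sup>+g. u g * q (Y g) + v g * q z \<partial>M) + (\<integral>\<^sup>+g. u g * p (Y g) + v g * p z \<partial>M)"
    using add pK by (simp add: nn_integral_add)
  also have "\<dots> = (\<integral>\<^sup>+g. (u g * q (Y g) + v g * q z) + (u g * p (Y g) + v g * p z) \<partial>M)"
    by (rule nn_integral_add[symmetric]) measurable
  finally show ?case by (simp add: algebra_simps)
next
  case (seq U)
  note [measurable] = seq(1)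
  have UK: "U i \<in> borel_measurable K" for i
    using seq(1)[of i] measurable_cong_sets[OF sets refl] by blast
  have inc: "incseq (\<lambda>i. u g * U i (Y g) + v g * U i z)" for g
    using \<open>incseq U\<close> by (auto simp: incseq_def le_fun_def intro!: add_mono mult_left_mono)
  have "(\<integral>\<^sup>+y. (SUP i. U i y) \<partial>K) = (SUP i. \<integral>\<^sup>+y. U i y \<partial>K)"
    by (rule nn_integral_monotone_convergence_SUP) (use seq UK in auto)
  also have "\<dots> = (SUP i. \<integral>\<^sup>+g. u g * U i (Y g) + v g * U i z \<partial>M)"
    using seq by simp
  also have "\<dots> = (\<integral>\<^sup>+g. (SUP i. u g * U i (Y g) + v g * U i z) \<partial>M)"
    by (rule nn_integral_monotone_convergence_SUP[symmetric])
       (use inc in \<open>auto simp: incseq_def le_fun_def\<close>)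
  also have "\<dots> = (\<integral>\<^sup>+g. u g * (SUP i. U i (Y g)) + v g * (SUP i. U i z) \<partial>M)"
  proof (intro nn_integral_cong)
    fix g
    have "(SUP i. u g * U i (Y g) + v g * U i z) = (SUP i. u g * U i (Y g)) + (SUP i. v g * U i z)"
      by (rule ennreal_SUP_add)
         (use \<open>incseq U\<close> in \<open>auto simp: incseq_def le_fun_def intro!: mult_left_mono\<close>)
    then show "(SUP i. u g * U i (Y g) + v g * U i z) = u g * (SUP i. U i (Y g)) + v g * (SUP i. U i z)"
      by (simp add: SUP_mult_left_ennreal)
  qed
  finally show ?case by (simp add: SUP_apply image_image)
qed

locale mala =
  fixes d :: nat and f :: "(nat \<Rightarrow> real) \<Rightarrow> real" and G :: "(nat \<Rightarrow> real) \<Rightarrow> nat \<Rightarrow> real" and h :: real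
  assumes f_meas [measurable]: "f \<in> borel_measurable (lebd d)"
    and G_meas [measurable]: "\<And>i. i < d \<Longrightarrow> (\<lambda>x. G x i) \<in> borel_measurable (lebd d)"
begin

abbreviation propose :: "(nat \<Rightarrow> real) \<Rightarrow> (nat \<Rightarrow> real) \<Rightarrow> nat \<Rightarrow> real" where
  "propose \<equiv> mala_prop d G h"

abbreviation acc :: "(nat \<Rightarrow> real) \<Rightarrow> (nat \<Rightarrow> real) \<Rightarrow> real" where
  "acc \<equiv> mala_acc d f G h"

abbreviation law :: "(nat \<Rightarrow> real) measure \<Rightarrow> nat \<Rightarrow> (nat \<Rightarrow> real) measure" where
  "law \<equiv> mala_law d f G h"

lemma acc_bounds: "0 \<le> acc x y" "acc x y \<le> 1"
  by (simp_all add: mala_acc_def)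

lemma propose_measurable [measurable]:
  "(\<lambda>p. propose (fst p) (snd p)) \<in> measurable (lebd d \<Otimes>\<^sub>M gaussd d) (lebd d)"
  unfolding mala_prop_def
proof (rule measurable_into_lebd)
  fix i assume [measurable]: "i < d"
  have [measurable]: "(\<lambda>p. G (fst p) i) \<in> borel_measurable (lebd d \<Otimes>\<^sub>M gaussd d)"
    using measurable_compose[OF measurable_fst G_meas[OF \<open>i < d\<close>]] by simp
  have [measurable]: "(\<lambda>p. fst p i) \<in> borel_measurable (lebd d \<Otimes>\<^sub>M gaussd d)"
    by (rule measurable_compose[OF measurable_fst measurable_lebd_component[OF \<open>i < d\<close>]])
  have "snd \<in> measurable (lebd d \<Otimes>\<^sub>M gaussd d) (lebd d)" by measurable
  from measurable_compose[OF this measurable_lebd_component[OF \<open>i < d\<close>]]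
  have [measurable]: "(\<lambda>p. snd p i) \<in> borel_measurable (lebd d \<Otimes>\<^sub>M gaussd d)" by simp
  show "(\<lambda>p. fst p i - h * G (fst p) i + sqrt (2 * h) * snd p i) \<in> borel_measurable (lebd d \<Otimes>\<^sub>M gaussd d)"
    by measurable
qed

lemma acc_measurable [measurable]:
  "(\<lambda>p. acc (fst p) (snd p)) \<in> borel_measurable (lebd d \<Otimes>\<^sub>M lebd d)"
proof -
  have [measurable]: "(\<lambda>p. G (fst p) i) \<in> borel_measurable (lebd d \<Otimes>\<^sub>M lebd d)"
    "(\<lambda>p. G (snd p) i) \<in> borel_measurable (lebd d \<Otimes>\<^sub>M lebd d)"
    "(\<lambda>p. fst p i) \<in> borel_measurable (lebd d \<Otimes>\<^sub>M lebd d)"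
    "(\<lambda>p. snd p i) \<in> borel_measurable (lebd d \<Otimes>\<^sub>M lebd d)" if "i < d" for i
    using measurable_compose[OF measurable_fst G_meas[OF that]]
      measurable_compose[OF measurable_snd G_meas[OF that]]
      measurable_compose[OF measurable_fst measurable_lebd_component[OF that]]
      measurable_compose[OF measurable_snd measurable_lebd_component[OF that]] by blast+
  have s: "(\<lambda>p. \<Sum>i<d. F p i * F p i) \<in> borel_measurable M"
    if "\<And>i. i < d \<Longrightarrow> (\<lambda>p. F p i) \<in> borel_measurable M" for F :: "'z \<Rightarrow> nat \<Rightarrow> real" and M
    using that by (intro borel_measurable_sum borel_measurable_times) auto
  show ?thesis
    unfolding mala_acc_def vnorm_def ip_def
    by (intro borel_measurable_min borel_measurable_const borel_measurable_exp borel_measurable_add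
      borel_measurable_diff borel_measurable_times borel_measurable_power borel_measurable_sqrt s
      ) (auto intro!: borel_measurable_add borel_measurable_diff borel_measurable_times)
qed

lemma acc_propose_measurable [measurable]:
  "(\<lambda>p. acc (fst p) (propose (fst p) (snd p))) \<in> borel_measurable (lebd d \<Otimes>\<^sub>M gaussd d)"
proof -
  have "(\<lambda>p. (fst p, propose (fst p) (snd p))) \<in> measurable (lebd d \<Otimes>\<^sub>M gaussd d) (lebd d \<Otimes>\<^sub>M lebd d)"
    by measurable
  from measurable_compose[OF this acc_measurable] show ?thesis by simp
qed

lemma propose_measurable' [measurable]: "x \<in> Rd d \<Longrightarrow> propose x \<in> measurable (gaussd d) (lebd d)"
  using measurable_Pair2[OF propose_measurable, of x] by (simp add: space_lebd)

lemma acc_propose_measurable' [measurable]: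
  "x \<in> Rd d \<Longrightarrow> (\<lambda>g. acc x (propose x g)) \<in> borel_measurable (gaussd d)"
  using measurable_Pair2[OF acc_propose_measurable, of x] by (simp add: space_lebd)

lemma mixture_measurable:
  assumes [measurable]: "\<psi> \<in> borel_measurable (lebd d)"
  shows "(\<lambda>x. \<integral>\<^sup>+g. ennreal (acc x (propose x g)) * \<psi> (propose x g) + ennreal (1 - acc x (propose x g)) * \<psi> x \<partial>gaussd d)
    \<in> borel_measurable (lebd d)"
proof -
  interpret g: prob_space "gaussd d" by (rule prob_space_gaussd)
  have [measurable]: "(\<lambda>p. \<psi> (propose (fst p) (snd p))) \<in> borel_measurable (lebd d \<Otimes>\<^sub>M gaussd d)"
    using measurable_compose[OF propose_measurable assms] by simp
  have [measurable]: "(\<lambda>p. \<psi> (fst p)) \<in> borel_measurable (lebd d \<Otimes>\<^sub>M gaussd d)"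
    using measurable_compose[OF measurable_fst assms] by simp
  have "(\<lambda>p. ennreal (acc (fst p) (propose (fst p) (snd p))) * \<psi> (propose (fst p) (snd p))
      + ennreal (1 - acc (fst p) (propose (fst p) (snd p))) * \<psi> (fst p)) \<in> borel_measurable (lebd d \<Otimes>\<^sub>M gaussd d)"
    by measurable
  from g.borel_measurable_nn_integral_fst[OF this] show ?thesis by simp
qed

lemma sets_kernel [simp, measurable_cong]: "sets (mala_kernel d f G h x) = sets (lebd d)"
  by (simp add: mala_kernel_def)

text \<open>\<open>measure_of\<close> takes the intended values only for a countably additive set
  function and would otherwise be the null measure. Additivity follows by exchanging sum and
  integral.\<close>

lemma emeasure_kernel:
  assumes x: "x \<in> Rd d" and A: "A \<in> sets (lebd d)"
  shows "emeasure (mala_kernel d f G h x) A =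
    (\<integral>\<^sup>+g. ennreal (acc x (propose x g)) * indicator A (propose x g)
         + ennreal (1 - acc x (propose x g)) * indicator A x \<partial>gaussd d)"
    (is "_ = ?\<mu> A")
proof (rule emeasure_measure_of[OF mala_kernel_def])
  note [measurable] = x
  show "sets (lebd d) \<subseteq> Pow (space (lebd d))" by (rule sets.space_closed)
  show "A \<in> sets (mala_kernel d f G h x)" using A by simp
  show "positive (sets (mala_kernel d f G h x)) ?\<mu>" by (simp add: positive_def)
  show "countably_additive (sets (mala_kernel d f G h x)) ?\<mu>"
  proof (rule countably_additiveI, unfold sets_kernel)
    fix B :: "nat \<Rightarrow> (nat \<Rightarrow> real) set"
    assume B: "range B \<subseteq> sets (lebd d)" "disjoint_family B"
    have [measurable]: "B i \<in> sets (lebd d)" for i using B(1) by auto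
    have "(\<Sum>i. ?\<mu> (B i)) = (\<integral>\<^sup>+g. (\<Sum>i. ennreal (acc x (propose x g)) * indicator (B i) (propose x g)
         + ennreal (1 - acc x (propose x g)) * indicator (B i) x) \<partial>gaussd d)"
      by (rule nn_integral_suminf[symmetric]) measurable
    also have "\<dots> = ?\<mu> (\<Union>i. B i)"
      using B(2) by (intro nn_integral_cong)
        (simp add: suminf_add[symmetric] ennreal_suminf_cmult suminf_indicator)
    finally show "(\<Sum>i. ?\<mu> (B i)) = ?\<mu> (\<Union>i. B i)" .
  qed
qed

lemma nn_integral_kernel:
  assumes x: "x \<in> Rd d" and \<psi>: "\<psi> \<in> borel_measurable (lebd d)"
  shows "(\<integral>\<^sup>+y. \<psi> y \<partial>mala_kernel d f G h x) =
    (\<integral>\<^sup>+g. ennreal (acc x (propose x g)) * \<psi> (propose x g) + ennreal (1 - acc x (propose x g)) * \<psi> x \<partial>gaussd d)"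
proof (rule nn_integral_eq_if_emeasure_mixture[OF sets_kernel _ _ _ _ emeasure_kernel[OF x] \<psi>])
  note [measurable] = x
  show "x \<in> space (lebd d)" using x by (simp add: space_lebd)
  show "propose x \<in> measurable (gaussd d) (lebd d)" by measurable
qed (use x in measurable)

lemma prob_space_kernel: "x \<in> Rd d \<Longrightarrow> prob_space (mala_kernel d f G h x)"
proof (rule prob_spaceI)
  assume x [measurable]: "x \<in> Rd d"
  interpret g: prob_space "gaussd d" by (rule prob_space_gaussd)
  have "(\<integral>\<^sup>+y. 1 \<partial>mala_kernel d f G h x) = (\<integral>\<^sup>+g. 1 \<partial>gaussd d)"
    unfolding nn_integral_kernel[OF x measurable_const[of 1]]
    by (subst nn_integral_kernel[OF x]) (auto intro!: nn_integral_cong simp: acc_bounds simp flip: ennreal_plus)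
  then show "emeasure (mala_kernel d f G h x) (space (mala_kernel d f G h x)) = 1"
    by (simp add: g.emeasure_space_1)
qed

lemma kernel_measurable [measurable]: "mala_kernel d f G h \<in> measurable (lebd d) (subprob_algebra (lebd d))"
proof (rule measurable_subprob_algebra)
  fix A assume A: "A \<in> sets (lebd d)"
  have "(\<lambda>x. emeasure (mala_kernel d f G h x) A) \<in> borel_measurable (lebd d) \<longleftrightarrow>
    (\<lambda>x. \<integral>\<^sup>+g. ennreal (acc x (propose x g)) * indicator A (propose x g)
         + ennreal (1 - acc x (propose x g)) * indicator A x \<partial>gaussd d) \<in> borel_measurable (lebd d)"
    by (rule measurable_cong) (simp add: emeasure_kernel A space_lebd)
  then show "(\<lambda>x. emeasure (mala_kernel d f G h x) A) \<in> borel_measurable (lebd d)"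
    using mixture_measurable[of "indicator A"] A by simp
qed (auto simp: space_lebd intro: prob_space_kernel prob_space_imp_subprob_space)

text \<open>Identifying the recursion with the Giry bind gives access to its rules for integrals and
  probability measures. The premise on \<open>sets\<close> is the induction hypothesis of
  \<open>law_prob_sets\<close>: the kernel has to be measurable on the current law.\<close>

lemma law_Suc:
  assumes sets: "sets (law \<mu> n) = sets (lebd d)"
  shows "law \<mu> (Suc n) = law \<mu> n \<bind> mala_kernel d f G h"
proof -
  have ne: "space (law \<mu> n) \<noteq> {}"
    using sets_eq_imp_space_eq[OF sets] by (auto simp: space_lebd Rd_def PiE_eq_empty_iff)
  have K: "mala_kernel d f G h \<in> measurable (law \<mu> n) (subprob_algebra (lebd d))"
    using kernel_measurable measurable_cong_sets[OF sets refl] by blast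
  have sb: "sets (law \<mu> n \<bind> mala_kernel d f G h) = sets (lebd d)"
    by (rule sets_bind[OF _ ne]) simp
  have "law \<mu> (Suc n) = measure_of (space (lebd d)) (sets (lebd d)) (emeasure (law \<mu> n \<bind> mala_kernel d f G h))"
    unfolding mala_law.simps
    by (rule measure_of_eq) (auto simp: sets.space_closed sets.sigma_sets_eq emeasure_bind[OF ne K])
  also have "\<dots> = law \<mu> n \<bind> mala_kernel d f G h"
    using sb sets_eq_imp_space_eq[OF sb] by (metis measure_of_of_measure)
  finally show ?thesis .
qed

section \<open>Drift bounds and chains that have never moved\<close>

definition total_acc :: "(nat \<Rightarrow> real) \<Rightarrow> ennreal" where
  "total_acc x = (\<integral>\<^sup>+g. ennreal (acc x (propose x g)) \<partial>gaussd d)"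

lemma total_acc_measurable [measurable]: "total_acc \<in> borel_measurable (lebd d)"
proof -
  interpret g: prob_space "gaussd d" by (rule prob_space_gaussd)
  have "(\<lambda>p. ennreal (acc (fst p) (propose (fst p) (snd p)))) \<in> borel_measurable (lebd d \<Otimes>\<^sub>M gaussd d)"
    by measurable
  from g.borel_measurable_nn_integral_fst[OF this] show ?thesis
    by (simp add: total_acc_def[abs_def])
qed

lemma total_acc_le_1: "total_acc x \<le> 1"
proof -
  interpret g: prob_space "gaussd d" by (rule prob_space_gaussd)
  have "total_acc x \<le> (\<integral>\<^sup>+g. 1 \<partial>gaussd d)"
    unfolding total_acc_def by (intro nn_integral_mono) (simp add: acc_bounds)
  then show ?thesis by (simp add: g.emeasure_space_1)
qed

text \<open>Of the two branches of the kernel only rejection is kept; the accepted branch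
  contributes a nonnegative amount.\<close>

lemma rejection_le_kernel:
  assumes x [measurable]: "x \<in> Rd d" and \<psi>: "\<psi> \<in> borel_measurable (lebd d)"
  shows "(1 - total_acc x) * \<psi> x \<le> (\<integral>\<^sup>+y. \<psi> y \<partial>mala_kernel d f G h x)"
proof -
  interpret g: prob_space "gaussd d" by (rule prob_space_gaussd)
  have "1 - total_acc x = (\<integral>\<^sup>+g. 1 \<partial>gaussd d) - (\<integral>\<^sup>+g. ennreal (acc x (propose x g)) \<partial>gaussd d)"
    by (simp add: total_acc_def g.emeasure_space_1)
  also have "\<dots> = (\<integral>\<^sup>+g. 1 - ennreal (acc x (propose x g)) \<partial>gaussd d)"
    by (rule nn_integral_diff[symmetric])
       (use total_acc_le_1[of x] in \<open>auto simp: total_acc_def acc_bounds top_unique\<close>)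
  also have "\<dots> = (\<integral>\<^sup>+g. ennreal (1 - acc x (propose x g)) \<partial>gaussd d)"
    by (intro nn_integral_cong) (simp add: acc_bounds ennreal_minus flip: ennreal_1)
  finally have "(1 - total_acc x) * \<psi> x = (\<integral>\<^sup>+g. ennreal (1 - acc x (propose x g)) * \<psi> x \<partial>gaussd d)"
    by (simp add: nn_integral_multc)
  also have "\<dots> \<le> (\<integral>\<^sup>+y. \<psi> y \<partial>mala_kernel d f G h x)"
    unfolding nn_integral_kernel[OF x \<psi>] by (intro nn_integral_mono) simp
  finally show ?thesis .
qed

context
  fixes \<mu> :: "(nat \<Rightarrow> real) measure"
  assumes \<mu>: "prob_space \<mu>" and sets_\<mu>: "sets \<mu> = sets (lebd d)"
begin

lemma law_prob_sets: "prob_space (law \<mu> n) \<and> sets (law \<mu> n) = sets (lebd d)"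
proof (induction n)
  case (Suc n)
  then interpret prob_space "law \<mu> n" by simp
  have sets: "sets (law \<mu> n) = sets (lebd d)" using Suc by simp
  have K: "mala_kernel d f G h \<in> measurable (law \<mu> n) (subprob_algebra (lebd d))"
    using kernel_measurable measurable_cong_sets[OF sets refl] by blast
  have "AE x in law \<mu> n. prob_space (mala_kernel d f G h x)"
    by (rule AE_I2) (use prob_space_kernel sets_eq_imp_space_eq[OF sets] space_lebd in auto)
  from prob_space_bind[OF this K] have "prob_space (law \<mu> (Suc n))"
    unfolding law_Suc[OF sets] .
  moreover have "sets (law \<mu> (Suc n)) = sets (lebd d)"
    unfolding law_Suc[OF sets] by (rule sets_bind) (use not_empty in auto)
  ultimately show ?case by simp
qed (use \<mu> sets_\<mu> in simp)

lemmas prob_space_law = law_prob_sets[THEN conjunct1]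
  and sets_law = law_prob_sets[THEN conjunct2]

lemma space_law: "space (law \<mu> n) = Rd d"
  using sets_eq_imp_space_eq[OF sets_law] by (simp add: space_lebd)

lemma nn_integral_law_Suc:
  assumes \<psi>: "\<psi> \<in> borel_measurable (lebd d)"
  shows "(\<integral>\<^sup>+x. \<psi> x \<partial>law \<mu> (Suc n)) = (\<integral>\<^sup>+x. \<integral>\<^sup>+y. \<psi> y \<partial>mala_kernel d f G h x \<partial>law \<mu> n)"
  unfolding law_Suc[OF sets_law]
  by (rule nn_integral_bind[OF \<psi>]) (use kernel_measurable measurable_cong_sets[OF sets_law refl] in blast)

lemma nn_integral_law_drift:
  assumes [measurable]: "\<psi> \<in> borel_measurable (lebd d)"
    and drift: "\<And>x. x \<in> Rd d \<Longrightarrow> (\<integral>\<^sup>+y. \<psi> y \<partial>mala_kernel d f G h x) \<le> \<psi> x + ennreal c" and c: "c \<ge> 0"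
  shows "(\<integral>\<^sup>+x. \<psi> x \<partial>law \<mu> n) \<le> (\<integral>\<^sup>+x. \<psi> x \<partial>\<mu>) + ennreal (real n * c)"
proof (induction n)
  case (Suc n)
  interpret prob_space "law \<mu> n" by (rule prob_space_law)
  have [measurable]: "\<psi> \<in> borel_measurable (law \<mu> n)"
    using assms(1) measurable_cong_sets[OF sets_law refl] by blast
  have "(\<integral>\<^sup>+x. \<psi> x \<partial>law \<mu> (Suc n)) \<le> (\<integral>\<^sup>+x. \<psi> x + ennreal c \<partial>law \<mu> n)"
    unfolding nn_integral_law_Suc[OF assms(1)]
    by (intro nn_integral_mono drift) (simp add: space_law)
  also have "\<dots> = (\<integral>\<^sup>+x. \<psi> x \<partial>law \<mu> n) + ennreal c"
    by (subst nn_integral_add) (auto simp: emeasure_space_1)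
  also have "\<dots> \<le> (\<integral>\<^sup>+x. \<psi> x \<partial>\<mu>) + ennreal (real n * c) + ennreal c"
    by (intro add_right_mono Suc)
  also have "\<dots> = (\<integral>\<^sup>+x. \<psi> x \<partial>\<mu>) + ennreal (real (Suc n) * c)"
    using c by (simp add: algebra_simps flip: ennreal_plus)
  finally show ?case .
qed simp

text \<open>The left side restricts the chain to trajectories that reject \<open>n\<close> times, on
  which it still sits at its start. The induction splits off the last step and moves its rejection
  factor onto the test function, hence the general \<open>\<psi>\<close>.\<close>

lemma never_accepted_le_law:
  assumes "\<psi> \<in> borel_measurable (lebd d)"
  shows "(\<integral>\<^sup>+x. (1 - total_acc x) ^ n * \<psi> x \<partial>\<mu>) \<le> (\<integral>\<^sup>+x. \<psi> x \<partial>law \<mu> n)"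
  using assms
proof (induction n arbitrary: \<psi>)
  case (Suc n)
  note [measurable] = Suc.prems
  have "(\<integral>\<^sup>+x. (1 - total_acc x) ^ Suc n * \<psi> x \<partial>\<mu>) = (\<integral>\<^sup>+x. (1 - total_acc x) ^ n * ((1 - total_acc x) * \<psi> x) \<partial>\<mu>)"
    by (simp add: mult_ac)
  also have "\<dots> \<le> (\<integral>\<^sup>+x. (1 - total_acc x) * \<psi> x \<partial>law \<mu> n)"
    by (rule Suc.IH) measurable
  also have "\<dots> \<le> (\<integral>\<^sup>+x. \<psi> x \<partial>law \<mu> (Suc n))"
    unfolding nn_integral_law_Suc[OF Suc.prems]
    by (intro nn_integral_mono rejection_le_kernel Suc.prems) (simp add: space_law)
  finally show ?case .
qed simp

text \<open>The event \<open>A\<close> carries the whole initial mass, so leaving it requires an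
  accepted move. Only the mean of \<open>total_acc\<close> under the initial law matters, because a
  trajectory without acceptance sees its starting point at every step.\<close>

lemma law_ge_stay:
  assumes A [measurable]: "A \<in> sets (lebd d)" and "emeasure \<mu> A = 1"
    and small: "(\<integral>\<^sup>+x. total_acc x \<partial>\<mu>) \<le> ennreal \<delta>" and \<delta>: "\<delta> \<ge> 0"
  shows "measure (law \<mu> n) A \<ge> 1 - real n * \<delta>"
proof -
  interpret mu: prob_space \<mu> by (rule \<mu>)
  interpret ln: prob_space "law \<mu> n" by (rule prob_space_law)
  have cong: "\<psi> \<in> borel_measurable \<mu>" if "\<psi> \<in> borel_measurable (lebd d)" for \<psi> :: "(nat \<Rightarrow> real) \<Rightarrow> ennreal"
    using that measurable_cong_sets[OF sets_\<mu> refl] by blast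
  note [measurable] = cong[OF total_acc_measurable]
  have [measurable]: "A \<in> sets \<mu>" using A sets_\<mu> by simp
  \<comment> \<open>Bernoulli's inequality in additive form, because subtraction in
    \<open>ennreal\<close> truncates at zero.\<close>
  have bern: "1 \<le> (1 - a) ^ n + of_nat n * a" if "a \<le> 1" for a :: ennreal
  proof -
    obtain r where r: "a = ennreal r" "0 \<le> r" "r \<le> 1" using \<open>a \<le> 1\<close> by (cases a) (auto simp: top_unique)
    have "1 - a = ennreal (1 - r)" using r by (simp add: ennreal_minus flip: ennreal_1)
    then have "(1 - a) ^ n + of_nat n * a = ennreal ((1 - r) ^ n + real n * r)"
      using r by (simp add: ennreal_power ennreal_mult' flip: ennreal_of_nat_eq_real_of_nat)
    moreover have "1 \<le> (1 - r) ^ n + real n * r"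
      using Bernoulli_inequality[of "-r" n] r by (simp add: algebra_simps)
    ultimately show ?thesis by simp
  qed
  have "1 = (\<integral>\<^sup>+x. 1 * indicator A x \<partial>\<mu>)" using assms(2) by simp
  also have "\<dots> \<le> (\<integral>\<^sup>+x. (1 - total_acc x) ^ n * indicator A x + of_nat n * total_acc x \<partial>\<mu>)"
    using bern total_acc_le_1 by (intro nn_integral_mono) (auto simp: indicator_def)
  also have "\<dots> = (\<integral>\<^sup>+x. (1 - total_acc x) ^ n * indicator A x \<partial>\<mu>) + of_nat n * (\<integral>\<^sup>+x. total_acc x \<partial>\<mu>)"
    by (subst nn_integral_add) (auto simp: nn_integral_cmult)
  also have "\<dots> \<le> emeasure (law \<mu> n) A + of_nat n * ennreal \<delta>"
    using never_accepted_le_law[of "indicator A" n] small A sets_law[of n]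
    by (intro add_mono mult_left_mono) auto
  also have "\<dots> = ennreal (measure (law \<mu> n) A + real n * \<delta>)"
    using \<delta> by (simp add: ln.emeasure_eq_measure ennreal_mult' flip: ennreal_of_nat_eq_real_of_nat)
  finally show ?thesis by simp
qed

end

end

section \<open>One-dimensional estimates\<close>

lemma integrable_std_normal_bounded:
  fixes F :: "real \<Rightarrow> real"
  assumes [measurable]: "F \<in> borel_measurable borel" and "\<And>x. \<bar>F x\<bar> \<le> B"
  shows "integrable std_normal_distribution F"
proof -
  interpret real_distribution std_normal_distribution by (rule real_dist_normal_dist)
  show ?thesis by (rule integrable_const_bound[where B = B]) (use assms(2) in auto)
qed

lemma std_normal_cos_sin:
  shows "(LINT g|std_normal_distribution. cos (t * g)) = exp (- t\<^sup>2 / 2)"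
    and "(LINT g|std_normal_distribution. sin (t * g)) = 0"
proof -
  interpret real_distribution std_normal_distribution by (rule real_dist_normal_dist)
  have c: "(CLINT g|std_normal_distribution. iexp (t * g)) = complex_of_real (exp (- t\<^sup>2 / 2))"
    using fun_cong[OF char_std_normal_distribution, of t] by (simp add: char_def)
  have i: "integrable std_normal_distribution (\<lambda>g. iexp (t * g))" by (rule integrable_iexp) simp_all
  show "(LINT g|std_normal_distribution. cos (t * g)) = exp (- t\<^sup>2 / 2)"
    using integral_Re[OF i] c by (simp add: Re_exp)
  show "(LINT g|std_normal_distribution. sin (t * g)) = 0"
    using integral_Im[OF i] c by (simp add: Im_exp)
qed

text \<open>Applied later with \<open>t = sqrt 2\<close>, the size of the proposal noise in units of
  \<open>sqrt h\<close>: this is the source of the factor \<open>exp (-1)\<close>.\<close>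

lemma std_normal_cos_shift:
  "(LINT g|std_normal_distribution. cos (m + t * g)) = exp (- t\<^sup>2 / 2) * cos m"
proof -
  have "integrable std_normal_distribution (\<lambda>g. cos (t * g))" "integrable std_normal_distribution (\<lambda>g. sin (t * g))"
    by (rule integrable_std_normal_bounded[where B = 1]; simp)+
  then show ?thesis by (simp add: cos_add std_normal_cos_sin)
qed

section \<open>Detailed balance in one coordinate\<close>

lemma nn_integral_std_normal_affine:
  assumes [measurable]: "F \<in> borel_measurable borel" and s: "s > 0"
  shows "(\<integral>\<^sup>+g. F (m + s * g) \<partial>std_normal_distribution) = (\<integral>\<^sup>+y. ennreal (normal_density m s y) * F y \<partial>lborel)"
proof -
  have "(\<integral>\<^sup>+y. ennreal (normal_density m s y) * F y \<partial>lborel)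
      = ennreal s * (\<integral>\<^sup>+g. ennreal (normal_density m s (m + s * g)) * F (m + s * g) \<partial>lborel)"
    using s by (subst nn_integral_real_affine[where c = s and t = m]) auto
  also have "\<dots> = (\<integral>\<^sup>+g. ennreal s * ennreal (normal_density m s (m + s * g)) * F (m + s * g) \<partial>lborel)"
    by (subst nn_integral_cmult[symmetric]) (auto simp: mult.assoc)
  also have "\<dots> = (\<integral>\<^sup>+g. ennreal (std_normal_density g) * F (m + s * g) \<partial>lborel)"
  proof (intro nn_integral_cong)
    fix g
    have "s * normal_density m s (m + s * g) = std_normal_density g"
      using s by (simp add: normal_density_def power_mult_distrib real_sqrt_mult)
    then show "ennreal s * ennreal (normal_density m s (m + s * g)) * F (m + s * g)
        = ennreal (std_normal_density g) * F (m + s * g)"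
      using s by (simp flip: ennreal_mult')
  qed
  also have "\<dots> = (\<integral>\<^sup>+g. F (m + s * g) \<partial>std_normal_distribution)"
    by (rule nn_integral_density[symmetric]) auto
  finally show ?thesis by simp
qed

text \<open>One coordinate's share of the exponent in \<open>mala_acc\<close>; for a separable
  potential the shares add up.\<close>

definition mh_log_ratio :: "(real \<Rightarrow> real) \<Rightarrow> (real \<Rightarrow> real) \<Rightarrow> real \<Rightarrow> real \<Rightarrow> real \<Rightarrow> real" where
  "mh_log_ratio \<phi> \<phi>' h x y = \<phi> x - \<phi> y + (1 / (4 * h)) * ((y - x + h * \<phi>' x)\<^sup>2 - (x - y + h * \<phi>' y)\<^sup>2)"

text \<open>The exponent is exactly the logarithm of backward over forward flow: both Gaussians have
  variance \<open>2 * h\<close>, so their normalising constants agree and only the exponents have to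
  match.\<close>

lemma mh_log_ratio_reversible:
  assumes h: "h > 0"
  shows "exp (- \<phi> x) * normal_density (x - h * \<phi>' x) (sqrt (2 * h)) y * exp (mh_log_ratio \<phi> \<phi>' h x y)
       = exp (- \<phi> y) * normal_density (y - h * \<phi>' y) (sqrt (2 * h)) x"
proof -
  have "- \<phi> x + (- (y - (x - h * \<phi>' x))\<^sup>2 / (2 * (sqrt (2 * h))\<^sup>2)) + mh_log_ratio \<phi> \<phi>' h x y
     = - \<phi> y + (- (x - (y - h * \<phi>' y))\<^sup>2 / (2 * (sqrt (2 * h))\<^sup>2))"
    using h by (simp add: mh_log_ratio_def field_simps)
  then have "exp (- \<phi> x) * exp (- (y - (x - h * \<phi>' x))\<^sup>2 / (2 * (sqrt (2 * h))\<^sup>2)) * exp (mh_log_ratio \<phi> \<phi>' h x y)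
     = exp (- \<phi> y) * exp (- (x - (y - h * \<phi>' y))\<^sup>2 / (2 * (sqrt (2 * h))\<^sup>2))"
    by (simp only: exp_add[symmetric])
  then show ?thesis by (simp add: normal_density_def)
qed

text \<open>Since the Metropolis filter satisfies detailed balance, dropping the minimum with 1 turns the
  acceptance probability from the start \<open>r e\<^sup>-\<^sup>\<phi>\<close> into the mean of \<open>r\<close> after one unadjusted
  Langevin step from stationarity.\<close>

lemma mean_mh_ratio_eq:
  assumes [measurable]: "\<phi> \<in> borel_measurable borel" "\<phi>' \<in> borel_measurable borel" "r \<in> borel_measurable borel"
    and h: "h > 0"
  shows "(\<integral>\<^sup>+x. \<integral>\<^sup>+g. ennreal (exp (- \<phi> x)) * r x *
            ennreal (exp (mh_log_ratio \<phi> \<phi>' h x (x - h * \<phi>' x + sqrt (2 * h) * g))) \<partial>std_normal_distribution \<partial>lborel)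
       = (\<integral>\<^sup>+y. ennreal (exp (- \<phi> y)) * (\<integral>\<^sup>+g. r (y - h * \<phi>' y + sqrt (2 * h) * g) \<partial>std_normal_distribution) \<partial>lborel)"
proof -
  let ?q = "\<lambda>x y. normal_density (x - h * \<phi>' x) (sqrt (2 * h)) y"
  have [measurable]: "(\<lambda>(x, y). mh_log_ratio \<phi> \<phi>' h x y) \<in> borel_measurable (borel \<Otimes>\<^sub>M borel)"
    unfolding mh_log_ratio_def by measurable
  have [measurable]: "(\<lambda>(x, y). ?q x y) \<in> borel_measurable (borel \<Otimes>\<^sub>M borel)"
    unfolding normal_density_def by measurable
  have s: "sqrt (2 * h) > 0" using h by simp
  have "(\<integral>\<^sup>+x. \<integral>\<^sup>+g. ennreal (exp (- \<phi> x)) * r x *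
            ennreal (exp (mh_log_ratio \<phi> \<phi>' h x (x - h * \<phi>' x + sqrt (2 * h) * g))) \<partial>std_normal_distribution \<partial>lborel)
     = (\<integral>\<^sup>+x. \<integral>\<^sup>+y. ennreal (?q x y) * (ennreal (exp (- \<phi> x)) * r x * ennreal (exp (mh_log_ratio \<phi> \<phi>' h x y))) \<partial>lborel \<partial>lborel)"
    by (intro nn_integral_cong nn_integral_std_normal_affine[OF _ s]) measurable
  \<comment> \<open>Detailed balance moves the weight from \<open>x\<close> to \<open>y\<close>;
    after the exchange of integrals, \<open>r\<close> is averaged over a proposal made from
    \<open>y\<close>.\<close>
  also have "\<dots> = (\<integral>\<^sup>+x. \<integral>\<^sup>+y. r x * (ennreal (exp (- \<phi> y)) * ennreal (?q y x)) \<partial>lborel \<partial>lborel)"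
  proof (intro nn_integral_cong)
    fix x y
    have "ennreal (?q x y) * (ennreal (exp (- \<phi> x)) * r x * ennreal (exp (mh_log_ratio \<phi> \<phi>' h x y)))
      = r x * ennreal (exp (- \<phi> x) * ?q x y * exp (mh_log_ratio \<phi> \<phi>' h x y))"
      by (simp add: ennreal_mult' mult_ac)
    then show "ennreal (?q x y) * (ennreal (exp (- \<phi> x)) * r x * ennreal (exp (mh_log_ratio \<phi> \<phi>' h x y)))
      = r x * (ennreal (exp (- \<phi> y)) * ennreal (?q y x))"
      unfolding mh_log_ratio_reversible[OF h] by (simp add: ennreal_mult')
  qed
  also have "\<dots> = (\<integral>\<^sup>+y. \<integral>\<^sup>+x. r x * (ennreal (exp (- \<phi> y)) * ennreal (?q y x)) \<partial>lborel \<partial>lborel)"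
    by (rule lborel_pair.Fubini') measurable
  also have "\<dots> = (\<integral>\<^sup>+y. ennreal (exp (- \<phi> y)) * (\<integral>\<^sup>+x. ennreal (?q y x) * r x \<partial>lborel) \<partial>lborel)"
    by (intro nn_integral_cong, subst nn_integral_cmult[symmetric]) (auto simp: mult_ac)
  also have "\<dots> = (\<integral>\<^sup>+y. ennreal (exp (- \<phi> y)) * (\<integral>\<^sup>+g. r (y - h * \<phi>' y + sqrt (2 * h) * g) \<partial>std_normal_distribution) \<partial>lborel)"
    by (intro nn_integral_cong arg_cong2[where f = "(*)"] refl nn_integral_std_normal_affine[symmetric] s) measurable
  finally show ?thesis .
qed

section \<open>Quadratic potential with an oscillation at the proposal scale\<close>

definition pot :: "real \<Rightarrow> real \<Rightarrow> real \<Rightarrow> real \<Rightarrow> real" where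
  "pot a b h x = a * x\<^sup>2 / 2 - b * h * cos (x / sqrt h)"

definition dpot :: "real \<Rightarrow> real \<Rightarrow> real \<Rightarrow> real \<Rightarrow> real" where
  "dpot a b h x = a * x + b * sqrt h * sin (x / sqrt h)"

text \<open>The prefactor \<open>h\<close> of the cosine in \<open>pot\<close> is chosen so that the
  curvature oscillates by \<open>b\<close> for every \<open>h\<close>, while the tilt of the density
  is governed by \<open>b * h\<close>.\<close>

definition ddpot :: "real \<Rightarrow> real \<Rightarrow> real \<Rightarrow> real \<Rightarrow> real" where
  "ddpot a b h x = a + b * cos (x / sqrt h)"

lemma pot_measurable [measurable]: "pot a b h \<in> borel_measurable borel" "dpot a b h \<in> borel_measurable borel"
  unfolding pot_def[abs_def] dpot_def[abs_def] by measurable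

lemma pot_deriv:
  assumes "h > 0"
  shows "(pot a b h has_real_derivative dpot a b h x) (at x)"
    and "(dpot a b h has_real_derivative ddpot a b h x) (at x)"
proof -
  obtain k where k: "k > 0" "sqrt h = k" "h = k * k" using assms by (intro that[of "sqrt h"]) auto
  show "(pot a b h has_real_derivative dpot a b h x) (at x)"
    unfolding pot_def[abs_def] dpot_def k(2) using k(1)
    by (auto intro!: derivative_eq_intros simp: k(3) field_simps)
  show "(dpot a b h has_real_derivative ddpot a b h x) (at x)"
    unfolding dpot_def[abs_def] ddpot_def k(2) using k(1)
    by (auto intro!: derivative_eq_intros simp: field_simps)
qed

lemma lipschitz_of_deriv_bound:
  fixes g :: "real \<Rightarrow> real"
  assumes "\<And>x. (g has_real_derivative g' x) (at x)" "\<And>x. \<bar>g' x\<bar> \<le> L"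
  shows "\<bar>g x - g y\<bar> \<le> L * \<bar>x - y\<bar>"
  using field_differentiable_bound[of UNIV g g' L x y] assms by auto

lemma pot_lipschitz:
  assumes h: "h > 0" and "a \<ge> 0" "b \<ge> 0"
  shows "\<bar>dpot a b h x - dpot a b h y\<bar> \<le> (a + b) * \<bar>x - y\<bar>"
    and "\<bar>ddpot a b h x - ddpot a b h y\<bar> \<le> b / sqrt h * \<bar>x - y\<bar>"
proof -
  show "\<bar>dpot a b h x - dpot a b h y\<bar> \<le> (a + b) * \<bar>x - y\<bar>"
  proof (rule lipschitz_of_deriv_bound[OF pot_deriv(2)[OF h]])
    fix x
    have "\<bar>b * cos (x / sqrt h)\<bar> \<le> b * 1"
      unfolding abs_mult using assms by (intro mult_mono) auto
    then show "\<bar>ddpot a b h x\<bar> \<le> a + b" using assms by (auto simp: ddpot_def)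
  qed
  show "\<bar>ddpot a b h x - ddpot a b h y\<bar> \<le> b / sqrt h * \<bar>x - y\<bar>"
  proof (rule lipschitz_of_deriv_bound)
    fix x
    show "(ddpot a b h has_real_derivative - (b / sqrt h * sin (x / sqrt h))) (at x)"
      unfolding ddpot_def[abs_def] using h by (auto intro!: derivative_eq_intros simp: field_simps simp del: real_sqrt_mult_self)
    have "\<bar>b / sqrt h * sin (x / sqrt h)\<bar> \<le> b / sqrt h * 1"
      unfolding abs_mult using assms by (intro mult_mono) auto
    then show "\<bar>- (b / sqrt h * sin (x / sqrt h))\<bar> \<le> b / sqrt h" by simp
  qed
qed

text \<open>Rescaling by \<open>sqrt a\<close> absorbs the quadratic part into a standard Gaussian.
  What remains of the potential is a bounded tilt, close to 1 when \<open>b * h\<close> is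
  small.\<close>

lemma nn_integral_pot:
  assumes [measurable]: "F \<in> borel_measurable borel" and a: "a > 0" and h: "h > 0"
  shows "(\<integral>\<^sup>+x. ennreal (exp (- pot a b h x)) * F x \<partial>lborel) =
    ennreal (sqrt (2 * pi / a)) * (\<integral>\<^sup>+z. ennreal (exp (b * h * cos (z / sqrt (a * h)))) * F (z / sqrt a) \<partial>std_normal_distribution)"
proof -
  let ?c = "1 / sqrt a"
  have "(\<integral>\<^sup>+x. ennreal (exp (- pot a b h x)) * F x \<partial>lborel)
     = ennreal ?c * (\<integral>\<^sup>+z. ennreal (exp (- pot a b h (0 + ?c * z))) * F (0 + ?c * z) \<partial>lborel)"
    using a by (subst nn_integral_real_affine[where c = ?c and t = 0]) auto
  also have "\<dots> = (\<integral>\<^sup>+z. ennreal ?c * (ennreal (exp (- pot a b h (0 + ?c * z))) * F (0 + ?c * z)) \<partial>lborel)"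
    by (subst nn_integral_cmult) auto
  also have "\<dots> = (\<integral>\<^sup>+z. ennreal (std_normal_density z) * (ennreal (sqrt (2 * pi / a)) *
        (ennreal (exp (b * h * cos (z / sqrt (a * h)))) * F (z / sqrt a))) \<partial>lborel)"
  proof (intro nn_integral_cong)
    fix z
    have "pot a b h (0 + ?c * z) = z\<^sup>2 / 2 - b * h * cos (z / sqrt (a * h))"
      using a by (simp add: pot_def power_divide real_sqrt_mult)
    then have "?c * exp (- pot a b h (0 + ?c * z))
        = std_normal_density z * (sqrt (2 * pi / a) * exp (b * h * cos (z / sqrt (a * h))))"
      using a by (simp add: std_normal_density_def real_sqrt_divide exp_add[symmetric] exp_diff field_simps exp_minus)
    then have "ennreal ?c * ennreal (exp (- pot a b h (0 + ?c * z)))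
        = ennreal (std_normal_density z) * (ennreal (sqrt (2 * pi / a)) * ennreal (exp (b * h * cos (z / sqrt (a * h)))))"
      using a by (simp flip: ennreal_mult')
    then show "ennreal ?c * (ennreal (exp (- pot a b h (0 + ?c * z))) * F (0 + ?c * z))
       = ennreal (std_normal_density z) * (ennreal (sqrt (2 * pi / a)) *
        (ennreal (exp (b * h * cos (z / sqrt (a * h)))) * F (z / sqrt a)))"
      by (simp add: mult.assoc[symmetric])
  qed
  also have "\<dots> = (\<integral>\<^sup>+z. ennreal (sqrt (2 * pi / a)) *
        (ennreal (exp (b * h * cos (z / sqrt (a * h)))) * F (z / sqrt a)) \<partial>std_normal_distribution)"
    by (rule nn_integral_density[symmetric]) auto
  also have "\<dots> = ennreal (sqrt (2 * pi / a)) * (\<integral>\<^sup>+z. ennreal (exp (b * h * cos (z / sqrt (a * h)))) * F (z / sqrt a) \<partial>std_normal_distribution)"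
    by (rule nn_integral_cmult) measurable
  finally show ?thesis .
qed

section \<open>Cosine moments under a small tilt\<close>

lemma cos_diff_le: "cos (A - t) \<le> cos A + t * sin A + (t::real)\<^sup>2"
proof -
  \<comment> \<open>The linear term is kept since \<open>t\<close> will be
    \<open>\<beta> * sin u\<close>, of the same order as the gain to be extracted.\<close>
  have "\<bar>cos (A - (0 + t)) - cos (A - 0) - sin (A - 0) * t\<bar> \<le> 1 * t\<^sup>2"
  proof (rule quadratic_remainder)
    fix x y :: real
    show "((\<lambda>s. cos (A - s)) has_real_derivative sin (A - x)) (at x)"
      by (auto intro!: derivative_eq_intros)
    show "\<bar>sin (A - x) - sin (A - y)\<bar> \<le> 1 * \<bar>x - y\<bar>"
      by (rule lipschitz_of_deriv_bound[where g' = "\<lambda>s. - cos (A - s)"])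
         (auto intro!: derivative_eq_intros)
  qed
  then show ?thesis by (simp add: mult.commute)
qed

lemma exp_le_quadratic:
  fixes t :: real assumes "\<bar>t\<bar> \<le> 1" shows "exp t \<le> 1 + t + t\<^sup>2"
proof (cases "t \<ge> 0")
  case True
  then show ?thesis using exp_bound[of t] assms by simp
next
  case False
  define s where "s = - t"
  have s: "s > 0" using False by (simp add: s_def)
  \<comment> \<open>The product equals \<open>1 + s ^ 3\<close>.\<close>
  have "1 \<le> (1 - s + s\<^sup>2) * (1 + s)"
    using s by (simp add: algebra_simps power2_eq_square)
  also have "\<dots> \<le> (1 - s + s\<^sup>2) * exp s"
    using s assms exp_ge_add_one_self[of s] by (intro mult_left_mono) (auto simp: s_def)
  finally have "exp (- s) \<le> 1 - s + s\<^sup>2"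
    by (simp add: exp_minus field_simps)
  then show ?thesis by (simp add: s_def)
qed

text \<open>The bound 2/5 has two uses: it stays below 1/2, the mean of a squared cosine over a
  period, with 1/10 to spare, and it bounds the threshold 1/e of the total variation claim.\<close>

lemma exp_minus_1_bounds: "0 < exp (-1::real)" "exp (-1::real) \<le> 2 / 5"
proof -
  have "5 / 2 \<le> exp (1::real)" using exp_lower_Taylor_quadratic[of 1] by simp
  then show "exp (-1::real) \<le> 2 / 5" by (simp add: exp_minus field_simps)
qed simp

text \<open>Expansion to first order in \<beta>, with \<open>A = (1 - \<alpha>) * u\<close>. The
  tilt contributes \<open>cos u * cos A\<close> and the drift \<open>sin u * sin A\<close>; they
  combine to \<open>cos (u - A) = cos (\<alpha> * u)\<close>, so every term on the left has an
  explicit Gaussian mean. The second-order errors are at most \<open>2 * \<beta>\<^sup>2\<close>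
  from the exponential, and \<open>\<beta>\<^sup>2\<close> each from the shifted cosine and from the
  product of the two linear corrections.\<close>

lemma tilted_cos_gap_pointwise:
  fixes u \<alpha> \<beta> :: real
  assumes \<beta>: "0 \<le> \<beta>" "\<beta> \<le> 1"
  shows "cos u - exp (-1) * cos ((1 - \<alpha>) * u) + \<beta> * ((cos u)\<^sup>2 - exp (-1) * cos (\<alpha> * u)) - 5 * \<beta>\<^sup>2
    \<le> exp (\<beta> * cos u) * (cos u - exp (-1) * cos ((1 - \<alpha>) * u - \<beta> * sin u))"
proof -
  define z K A C where "z = cos u" and "K = exp (-1::real)" and "A = (1 - \<alpha>) * u"
    and "C = cos (A - \<beta> * sin u)"
  have K: "0 < K" "K \<le> 1/2" using exp_minus_1_bounds by (auto simp: K_def)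
  have z: "\<bar>z\<bar> \<le> 1" by (simp add: z_def)
  have Cb: "\<bar>C\<bar> \<le> 1" by (simp add: C_def)
  have \<beta>z: "\<bar>\<beta> * z\<bar> \<le> \<beta>" using mult_left_mono[OF z \<beta>(1)] \<beta> by (simp add: abs_mult)
  have C: "C \<le> cos A + \<beta> * sin u * sin A + \<beta>\<^sup>2"
  proof -
    have "(\<beta> * sin u)\<^sup>2 \<le> \<beta>\<^sup>2" by (simp add: power_mult_distrib mult_left_le sin_squared_eq)
    then show ?thesis using cos_diff_le[of A "\<beta> * sin u"] unfolding C_def by linarith
  qed
  define F where "F = z - K * C"
  have KC: "\<bar>K * C\<bar> \<le> 1"
    using mult_mono[of "\<bar>K\<bar>" 1 "\<bar>C\<bar>" 1] K Cb by (simp add: abs_mult)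
  have F: "\<bar>F\<bar> \<le> 2" using z KC by (auto simp: F_def)
  have E: "\<bar>exp (\<beta> * z) - (1 + \<beta> * z)\<bar> \<le> \<beta>\<^sup>2"
  proof -
    have "exp (\<beta> * z) \<le> 1 + \<beta> * z + (\<beta> * z)\<^sup>2" by (rule exp_le_quadratic) (use \<beta>z \<beta> in linarith)
    moreover have "(\<beta> * z)\<^sup>2 \<le> \<beta>\<^sup>2" using power_mono[OF \<beta>z, of 2] by simp
    moreover have "1 + \<beta> * z \<le> exp (\<beta> * z)" by (rule exp_ge_add_one_self)
    ultimately show ?thesis by linarith
  qed
  have "\<bar>(exp (\<beta> * z) - (1 + \<beta> * z)) * F\<bar> \<le> \<beta>\<^sup>2 * 2"
    unfolding abs_mult by (intro mult_mono E F) auto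
  then have 1: "exp (\<beta> * z) * F \<ge> (1 + \<beta> * z) * F - 2 * \<beta>\<^sup>2"
    by (simp add: algebra_simps abs_if split: if_splits)
  define F1 where "F1 = z - K * (cos A + \<beta> * sin u * sin A)"
  have "F \<ge> F1 - K * \<beta>\<^sup>2"
    using mult_left_mono[OF C, of K] K by (simp add: F_def F1_def algebra_simps)
  then have "(1 + \<beta> * z) * F \<ge> (1 + \<beta> * z) * (F1 - K * \<beta>\<^sup>2)"
    using \<beta>z \<beta> by (intro mult_left_mono) auto
  moreover have "(1 + \<beta> * z) * (K * \<beta>\<^sup>2) \<le> 2 * (1/2 * \<beta>\<^sup>2)"
    using \<beta>z \<beta> K by (intro mult_mono) auto
  ultimately have 2: "(1 + \<beta> * z) * F \<ge> (1 + \<beta> * z) * F1 - \<beta>\<^sup>2"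
    by (simp add: algebra_simps)
  have "cos (\<alpha> * u) = cos (u - A)" by (simp add: A_def algebra_simps)
  then have cau: "cos (\<alpha> * u) = z * cos A + sin u * sin A" by (simp add: cos_diff z_def)
  have 3: "(1 + \<beta> * z) * F1 = z - K * cos A + \<beta> * (z\<^sup>2 - K * cos (\<alpha> * u)) - \<beta>\<^sup>2 * (K * (z * (sin u * sin A)))"
    unfolding cau F1_def by (simp add: algebra_simps power2_eq_square)
  have "\<bar>K * (z * (sin u * sin A))\<bar> \<le> 1 * (1 * (1 * 1))"
    unfolding abs_mult by (intro mult_mono) (use K z in auto)
  then have "\<beta>\<^sup>2 * (K * (z * (sin u * sin A))) \<le> \<beta>\<^sup>2 * 1" by (intro mult_left_mono) auto
  with 1 2 3 have "exp (\<beta> * z) * F \<ge> z - K * cos A + \<beta> * (z\<^sup>2 - K * cos (\<alpha> * u)) - 5 * \<beta>\<^sup>2"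
    using zero_le_power2[of \<beta>] by linarith
  then show ?thesis by (simp add: F_def C_def z_def K_def A_def)
qed

text \<open>The tilted Gaussian moments below are taken in the variable \<open>u = x / sqrt h\<close>, whose law under the
  Gaussian part of the potential has variance \<open>1 / \<alpha>\<close>.\<close>

lemma tilted_cos_moments:
  fixes \<alpha> \<beta> :: real
  assumes \<beta>: "0 \<le> \<beta>" "\<beta> \<le> 1 / 100" and \<alpha>: "\<alpha> > 0"
  defines "u \<equiv> \<lambda>z. z / sqrt \<alpha>"
  defines "Z \<equiv> LINT z|std_normal_distribution. exp (\<beta> * cos (u z))"
    and "m1 \<equiv> LINT z|std_normal_distribution. exp (\<beta> * cos (u z)) * cos (u z)"
    and "m2 \<equiv> LINT z|std_normal_distribution.
      exp (\<beta> * cos (u z)) * (exp (-1) * cos ((1 - \<alpha>) * u z - \<beta> * sin (u z)))"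
  shows "0 < Z" "Z \<le> 2" "0 \<le> m1" "m1 \<le> Z" "m2 \<le> m1 - \<beta> / 20" "- Z \<le> m2"
proof -
  interpret real_distribution std_normal_distribution by (rule real_dist_normal_dist)
  have [measurable]: "u \<in> borel_measurable borel" unfolding u_def by measurable
  have e: "exp (\<beta> * cos x) \<le> 2" "exp (\<beta> * cos x) \<ge> 1/2" for x
  proof -
    have *: "\<beta> * cos x \<le> \<beta>" "- \<beta> \<le> \<beta> * cos x"
      using mult_left_mono[OF cos_le_one[of x] \<beta>(1)] mult_left_mono[OF cos_ge_minus_one[of x] \<beta>(1)] by auto
    have "exp (\<beta> * cos x) \<le> exp (1 / 100)" using * \<beta> by simp
    also have "\<dots> \<le> 1 + 1 / 100 + (1 / 100)\<^sup>2" by (rule exp_le_quadratic) simp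
    also have "\<dots> \<le> 2" by (simp add: power2_eq_square)
    finally show "exp (\<beta> * cos x) \<le> 2" .
    show "exp (\<beta> * cos x) \<ge> 1/2" using exp_ge_add_one_self[of "\<beta> * cos x"] * \<beta> by linarith
  qed
  have K: "0 < exp (-1::real)" "exp (-1::real) \<le> 2 / 5" by (rule exp_minus_1_bounds)+
  have int: "integrable std_normal_distribution (\<lambda>z. exp (\<beta> * cos (u z)) * F z)"
    if [measurable]: "F \<in> borel_measurable borel" and "\<And>z. \<bar>F z\<bar> \<le> 1" for F :: "real \<Rightarrow> real"
  proof (rule integrable_std_normal_bounded[where B = 2])
    fix z show "\<bar>exp (\<beta> * cos (u z)) * F z\<bar> \<le> 2"
      using mult_mono[OF e(1) that(2)[of z], of "u z"] by (simp add: abs_mult)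
  qed measurable
  have ib: "integrable std_normal_distribution F"
    if "F \<in> borel_measurable borel" "\<And>z. \<bar>F z\<bar> \<le> 1" for F :: "real \<Rightarrow> real"
    using integrable_std_normal_bounded that by blast
  have iZ: "integrable std_normal_distribution (\<lambda>z. exp (\<beta> * cos (u z)))"
    using int[of "\<lambda>_. 1"] by simp
  have cu: "(LINT z|std_normal_distribution. cos (t * u z)) = exp (- t\<^sup>2 / (2 * \<alpha>))" for t
    using std_normal_cos_sin(1)[of "t / sqrt \<alpha>"] \<alpha> by (simp add: u_def power_divide field_simps)
  have i1: "integrable std_normal_distribution (\<lambda>z. exp (\<beta> * cos (u z)) * cos (u z))"
    by (rule int) auto
  have Kc: "\<bar>exp (-1) * cos x\<bar> \<le> 1" for x :: real
    using mult_mono[of "exp (-1::real)" 1 "\<bar>cos x\<bar>" 1] K by (simp add: abs_mult)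
  have i2: "integrable std_normal_distribution
     (\<lambda>z. exp (\<beta> * cos (u z)) * (exp (-1) * cos ((1 - \<alpha>) * u z - \<beta> * sin (u z))))"
    by (rule int) (use Kc in auto)
  have "1/2 \<le> Z"
    unfolding Z_def by (rule integral_ge_const[OF iZ]) (use e in auto)
  then show "0 < Z" by simp
  show "Z \<le> 2"
    unfolding Z_def by (rule integral_le_const[OF iZ]) (use e in auto)
  show "m1 \<le> Z"
    unfolding m1_def Z_def by (intro integral_mono i1 iZ) (auto intro!: mult_left_le)
  show "- Z \<le> m2"
  proof -
    have "(LINT z|std_normal_distribution. - exp (\<beta> * cos (u z))) \<le> m2"
      unfolding m2_def
    proof (intro integral_mono i2 integrable_minus iZ)
      fix z
      have "exp (\<beta> * cos (u z)) * (-1) \<le> exp (\<beta> * cos (u z)) * (exp (-1) * cos ((1 - \<alpha>) * u z - \<beta> * sin (u z)))"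
        by (rule mult_left_mono) (use Kc[of "(1 - \<alpha>) * u z - \<beta> * sin (u z)"] in auto)
      then show "- exp (\<beta> * cos (u z)) \<le> exp (\<beta> * cos (u z)) * (exp (-1) * cos ((1 - \<alpha>) * u z - \<beta> * sin (u z)))"
        by simp
    qed
    then show ?thesis using iZ by (simp add: Z_def)
  qed
  show "0 \<le> m1"
  proof -
    have "0 \<le> (LINT z|std_normal_distribution. cos (1 * u z))" unfolding cu by simp
    also have "\<dots> \<le> m1"
      unfolding m1_def
    proof (intro integral_mono i1)
      show "integrable std_normal_distribution (\<lambda>z. cos (1 * u z))" by (rule ib) auto
      fix z
      define c where "c = cos (u z)"
      \<comment> \<open>The tilt is monotone in the cosine, so it weights positive values up and
        negative ones down.\<close>
      have "0 \<le> (exp (\<beta> * c) - 1) * c"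
      proof (cases "c \<ge> 0")
        case True then show ?thesis using \<beta> by (intro mult_nonneg_nonneg) auto
      next
        case False then show ?thesis using \<beta> by (intro mult_nonpos_nonpos) (auto simp: mult_nonneg_nonpos)
      qed
      then show "cos (1 * u z) \<le> exp (\<beta> * cos (u z)) * cos (u z)" by (simp add: c_def algebra_simps)
    qed
    finally show ?thesis .
  qed
  show "m2 \<le> m1 - \<beta> / 20"
  proof -
    \<comment> \<open>The lower bound of \<open>tilted_cos_gap_pointwise\<close>, with the squared
      cosine linearised by the double angle so that \<open>cu\<close> integrates every term.\<close>
    let ?L = "\<lambda>z. cos (1 * u z) - exp (-1) * cos ((1 - \<alpha>) * u z)
      + \<beta> * ((1 + cos (2 * u z)) / 2 - exp (-1) * cos (\<alpha> * u z)) - 5 * \<beta>\<^sup>2"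
    have ic: "integrable std_normal_distribution (\<lambda>z. cos (t * u z))" for t
      by (rule ib) auto
    have "(LINT z|std_normal_distribution. ?L z) =
        exp (- 1\<^sup>2 / (2 * \<alpha>)) - exp (-1) * exp (- (1 - \<alpha>)\<^sup>2 / (2 * \<alpha>))
        + \<beta> * ((1 + exp (- 2\<^sup>2 / (2 * \<alpha>))) / 2 - exp (-1) * exp (- \<alpha>\<^sup>2 / (2 * \<alpha>))) - 5 * \<beta>\<^sup>2"
      unfolding cu[symmetric] using ic ic[of 1] prob_space by simp
    \<comment> \<open>Completing the square: the two exponents differ by
      \<open>\<alpha> / 2\<close>, so the term of order zero in \<beta> has the right sign for every
      \<alpha>.\<close>
    moreover have "exp (-1) * exp (- (1 - \<alpha>)\<^sup>2 / (2 * \<alpha>)) \<le> exp (- 1\<^sup>2 / (2 * \<alpha>))"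
    proof -
      have "-1 + (- (1 - \<alpha>)\<^sup>2 / (2 * \<alpha>)) = - 1\<^sup>2 / (2 * \<alpha>) - \<alpha> / 2"
        using \<alpha> by (simp add: field_simps power2_eq_square)
      then show ?thesis unfolding exp_add[symmetric] using \<alpha> by simp
    qed
    \<comment> \<open>First-order gain: at least 1/2 from the squared cosine, less at most 2/5 from
      the damped one.\<close>
    moreover have "\<beta> * (1 / 10) \<le> \<beta> * ((1 + exp (- 2\<^sup>2 / (2 * \<alpha>))) / 2 - exp (-1) * exp (- \<alpha>\<^sup>2 / (2 * \<alpha>)))"
    proof (rule mult_left_mono[OF _ \<beta>(1)])
      have le: "1 / 10 \<le> (1 + p) / 2 - q" if "q \<le> 2 / 5 * 1" "0 < p" for p q :: real
        using that by (simp add: field_simps)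
      show "1 / 10 \<le> (1 + exp (- 2\<^sup>2 / (2 * \<alpha>))) / 2 - exp (-1) * exp (- \<alpha>\<^sup>2 / (2 * \<alpha>))"
        using K \<alpha> by (intro le mult_mono) auto
    qed
    \<comment> \<open>Here \<beta> \<le> 1/100 is used: the error costs at most half of the gain
      \<beta>/10.\<close>
    moreover have "5 * \<beta>\<^sup>2 \<le> \<beta> / 20"
      using mult_left_mono[OF \<beta>(2,1)] by (simp add: power2_eq_square)
    moreover have "(LINT z|std_normal_distribution. ?L z) \<le> m1 - m2"
    proof -
      have "(LINT z|std_normal_distribution. ?L z) \<le> (LINT z|std_normal_distribution.
          exp (\<beta> * cos (u z)) * cos (u z) - exp (\<beta> * cos (u z)) * (exp (-1) * cos ((1 - \<alpha>) * u z - \<beta> * sin (u z))))"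
      proof (rule integral_mono[OF _ Bochner_Integration.integrable_diff[OF i1 i2]])
        show "integrable std_normal_distribution ?L" using ic ic[of 1] by simp
        fix z
        have "(1 + cos (2 * u z)) / 2 = (cos (u z))\<^sup>2" by (simp add: cos_double_cos)
        then show "?L z \<le> exp (\<beta> * cos (u z)) * cos (u z)
            - exp (\<beta> * cos (u z)) * (exp (-1) * cos ((1 - \<alpha>) * u z - \<beta> * sin (u z)))"
          using tilted_cos_gap_pointwise[of \<beta> "u z" \<alpha>] \<beta> by (simp add: algebra_simps)
      qed
      then show ?thesis using i1 i2 by (simp add: m1_def m2_def)
    qed
    ultimately show ?thesis by linarith
  qed
qed

text \<open>\<open>m\<close> is the mean of the cosine under the normalised density, so
  \<open>(1 + cos (x / sqrt h)) / (1 + m)\<close> is a probability density relative to it. The last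
  bound is the factor gained per coordinate; \<open>0 \<le> m\<close> later keeps that relative
  density below 2.\<close>

lemma cos_coordinate:
  assumes a: "a > 0" and h: "h > 0" and b: "b \<ge> 0" and bh: "b * h \<le> 1 / 100"
  obtains W m where "W > 0" "0 \<le> m" "m \<le> 1"
    "(\<integral>\<^sup>+x. ennreal (exp (- pot a b h x)) \<partial>lborel) = ennreal W"
    "(\<integral>\<^sup>+x. ennreal (exp (- pot a b h x)) * ennreal (1 + cos (x / sqrt h)) \<partial>lborel) = ennreal (W * (1 + m))"
    "(\<integral>\<^sup>+y. ennreal (exp (- pot a b h y)) * (\<integral>\<^sup>+g. ennreal (1 + cos ((y - h * dpot a b h y + sqrt (2 * h) * g) / sqrt h))
        \<partial>std_normal_distribution) \<partial>lborel) \<le> ennreal (W * (1 + m) * (1 - b * h / 80))"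
proof -
  define \<alpha> \<beta> where "\<alpha> = a * h" and "\<beta> = b * h"
  define u :: "real \<Rightarrow> real" where "u = (\<lambda>z. z / sqrt \<alpha>)"
  have \<alpha>: "\<alpha> > 0" and \<beta>: "0 \<le> \<beta>" "\<beta> \<le> 1 / 100" using assms by (auto simp: \<alpha>_def \<beta>_def)
  define Z where "Z = (LINT z|std_normal_distribution. exp (\<beta> * cos (u z)))"
  define m1 where "m1 = (LINT z|std_normal_distribution. exp (\<beta> * cos (u z)) * cos (u z))"
  define m2 where "m2 = (LINT z|std_normal_distribution.
      exp (\<beta> * cos (u z)) * (exp (-1) * cos ((1 - \<alpha>) * u z - \<beta> * sin (u z))))"
  define C where "C = sqrt (2 * pi / a)"
  have C: "C > 0" using a by (simp add: C_def)
  have mom: "0 < Z" "Z \<le> 2" "0 \<le> m1" "m1 \<le> Z" "m2 \<le> m1 - \<beta> / 20" "- Z \<le> m2"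
    using tilted_cos_moments[OF \<beta> \<alpha>] unfolding Z_def m1_def m2_def u_def by blast+
  have [measurable]: "u \<in> borel_measurable borel" unfolding u_def by measurable
  interpret N: real_distribution std_normal_distribution by (rule real_dist_normal_dist)
  have K: "0 < exp (-1::real)" "exp (-1::real) \<le> 1" by auto
  have E: "(\<integral>\<^sup>+z. ennreal (exp (\<beta> * cos (u z))) * ennreal (1 + F z) \<partial>std_normal_distribution)
      = ennreal (Z + (LINT z|std_normal_distribution. exp (\<beta> * cos (u z)) * F z))"
    if F [measurable]: "F \<in> borel_measurable borel" and b: "\<And>z. \<bar>F z\<bar> \<le> 1" for F
  proof -
    have bound: "exp (\<beta> * cos (u z)) \<le> exp \<beta>" for z
      using mult_left_mono[OF cos_le_one[of "u z"] \<beta>(1)] by simp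
    have int: "integrable std_normal_distribution (\<lambda>z. exp (\<beta> * cos (u z)) * F z)"
    proof (rule integrable_std_normal_bounded[where B = "exp \<beta>"])
      fix z show "\<bar>exp (\<beta> * cos (u z)) * F z\<bar> \<le> exp \<beta>"
        using mult_mono[OF bound[of z] b[of z]] by (simp add: abs_mult)
    qed measurable
    have intZ: "integrable std_normal_distribution (\<lambda>z. exp (\<beta> * cos (u z)))"
      by (rule integrable_std_normal_bounded[where B = "exp \<beta>"]) (use bound in auto)
    have "(\<integral>\<^sup>+z. ennreal (exp (\<beta> * cos (u z))) * ennreal (1 + F z) \<partial>std_normal_distribution)
       = (\<integral>\<^sup>+z. ennreal (exp (\<beta> * cos (u z)) + exp (\<beta> * cos (u z)) * F z) \<partial>std_normal_distribution)"
      by (intro nn_integral_cong) (simp add: distrib_left flip: ennreal_mult')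
    also have "\<dots> = ennreal (LINT z|std_normal_distribution. exp (\<beta> * cos (u z)) + exp (\<beta> * cos (u z)) * F z)"
    proof (rule nn_integral_eq_integral)
      have "0 \<le> exp (\<beta> * cos (u z)) * (1 + F z)" for z
        using b[of z] by (intro mult_nonneg_nonneg) auto
      then show "AE z in std_normal_distribution. 0 \<le> exp (\<beta> * cos (u z)) + exp (\<beta> * cos (u z)) * F z"
        by (simp add: distrib_left)
    qed (use int intZ in simp)
    also have "\<dots> = ennreal (Z + (LINT z|std_normal_distribution. exp (\<beta> * cos (u z)) * F z))"
      using int intZ by (simp add: Z_def)
    finally show ?thesis .
  qed
  have scale: "z / sqrt a / sqrt h = u z" "z / (sqrt a * sqrt h) = u z" for z
    by (simp_all add: u_def \<alpha>_def real_sqrt_mult)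
  have P: "(\<integral>\<^sup>+x. ennreal (exp (- pot a b h x)) * ennreal (F x) \<partial>lborel)
      = ennreal C * (\<integral>\<^sup>+z. ennreal (exp (\<beta> * cos (u z))) * ennreal (F (z / sqrt a)) \<partial>std_normal_distribution)"
    if [measurable]: "F \<in> borel_measurable borel" for F
    using nn_integral_pot[of "\<lambda>x. ennreal (F x)", OF _ a h] that by (simp add: C_def u_def \<alpha>_def \<beta>_def)
  show thesis
  proof (rule that[of "C * Z" "m1 / Z"])
    show "C * Z > 0" "0 \<le> m1 / Z" "m1 / Z \<le> 1" using mom C by auto
    have W1: "C * Z * (1 + m1 / Z) = C * (Z + m1)" using mom by (simp add: field_simps)
    show "(\<integral>\<^sup>+x. ennreal (exp (- pot a b h x)) \<partial>lborel) = ennreal (C * Z)"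
      using P[of "\<lambda>_. 1"] E[of "\<lambda>_. 0"] C by (simp add: ennreal_mult')
    show "(\<integral>\<^sup>+x. ennreal (exp (- pot a b h x)) * ennreal (1 + cos (x / sqrt h)) \<partial>lborel)
        = ennreal (C * Z * (1 + m1 / Z))"
      unfolding W1 using P[of "\<lambda>x. 1 + cos (x / sqrt h)"] E[of "\<lambda>z. cos (u z)"] C
      by (simp add: ennreal_mult' scale m1_def)
    have inner: "(\<integral>\<^sup>+g. ennreal (1 + cos ((y - h * dpot a b h y + sqrt (2 * h) * g) / sqrt h)) \<partial>std_normal_distribution)
        = ennreal (1 + exp (-1) * cos ((1 - \<alpha>) * (y / sqrt h) - \<beta> * sin (y / sqrt h)))" for y
    proof -
      obtain k where k: "k > 0" "sqrt h = k" "h = k * k" using h by (intro that[of "sqrt h"]) auto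
      \<comment> \<open>In the phase \<open>y / sqrt h\<close> the quadratic drift multiplies by
        \<open>1 - \<alpha>\<close>, the oscillating drift subtracts \<beta> times the sine, and the
        noise becomes \<open>sqrt 2 * g\<close>.\<close>
      have eq: "(y - h * dpot a b h y + sqrt (2 * h) * g) / sqrt h
          = ((1 - \<alpha>) * (y / sqrt h) - \<beta> * sin (y / sqrt h)) + sqrt 2 * g" for g
        unfolding real_sqrt_mult dpot_def \<alpha>_def \<beta>_def k(2) using k(1) by (simp add: k(3) field_simps)
      let ?m = "(1 - \<alpha>) * (y / sqrt h) - \<beta> * sin (y / sqrt h)"
      have ic: "integrable std_normal_distribution (\<lambda>g. cos (?m + sqrt 2 * g))"
        by (rule integrable_std_normal_bounded[where B = 1]) auto
      have ge: "0 \<le> 1 + cos x" for x :: real using cos_ge_minus_one[of x] by linarith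
      have "(\<integral>\<^sup>+g. ennreal (1 + cos (?m + sqrt 2 * g)) \<partial>std_normal_distribution)
          = ennreal (LINT g|std_normal_distribution. 1 + cos (?m + sqrt 2 * g))"
        by (rule nn_integral_eq_integral) (use ic ge in auto)
      also have "(LINT g|std_normal_distribution. 1 + cos (?m + sqrt 2 * g)) = 1 + exp (-1) * cos ?m"
        using ic std_normal_cos_shift[of ?m "sqrt 2"] N.prob_space by simp
      finally show ?thesis unfolding eq .
    qed
    let ?F = "\<lambda>y. exp (-1) * cos ((1 - \<alpha>) * (y / sqrt h) - \<beta> * sin (y / sqrt h))"
    have Fb: "\<bar>exp (-1) * cos x\<bar> \<le> 1" for x :: real
      using mult_mono[of "exp (-1::real)" 1 "\<bar>cos x\<bar>" 1] K by (simp add: abs_mult)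
    have "(\<integral>\<^sup>+y. ennreal (exp (- pot a b h y)) * ennreal (1 + ?F y) \<partial>lborel) = ennreal (C * (Z + m2))"
      using P[of "\<lambda>y. 1 + ?F y"] E[of "\<lambda>z. exp (-1) * cos ((1 - \<alpha>) * u z - \<beta> * sin (u z))"] C Fb
      by (simp add: ennreal_mult' scale m2_def)
    also have "\<dots> \<le> ennreal (C * (Z + m1) * (1 - b * h / 80))"
    proof (rule ennreal_leI)
      \<comment> \<open>The absolute loss \<beta>/20 becomes the relative loss \<beta>/80 because
        \<open>Z + m1 \<le> 4\<close>.\<close>
      have "(Z + m1) * (\<beta> / 80) \<le> 4 * (\<beta> / 80)" using mom \<beta> by (intro mult_right_mono) auto
      moreover have "m2 \<le> m1 - 4 * (\<beta> / 80)" using mom by simp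
      ultimately have "m2 \<le> m1 - (Z + m1) * (\<beta> / 80)" by (meson diff_left_mono order.trans)
      then have "Z + m2 \<le> (Z + m1) * (1 - \<beta> / 80)"
        by (simp add: right_diff_distrib)
      then have "Z + m2 \<le> (Z + m1) * (1 - b * h / 80)" by (simp add: \<beta>_def)
      then show "C * (Z + m2) \<le> C * (Z + m1) * (1 - b * h / 80)"
        using mult_left_mono[of "Z + m2" _ C] C by (simp add: mult.assoc)
    qed
    finally show "(\<integral>\<^sup>+y. ennreal (exp (- pot a b h y)) * (\<integral>\<^sup>+g. ennreal (1 + cos ((y - h * dpot a b h y + sqrt (2 * h) * g) / sqrt h))
        \<partial>std_normal_distribution) \<partial>lborel) \<le> ennreal (C * Z * (1 + m1 / Z) * (1 - b * h / 80))"
      unfolding inner W1 .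
  qed
qed

section \<open>MALA for separable potentials\<close>

lemma nn_integral_std_normal_uminus:
  assumes [measurable]: "F \<in> borel_measurable borel"
  shows "(\<integral>\<^sup>+g. F (- g) \<partial>std_normal_distribution) = (\<integral>\<^sup>+g. F g \<partial>std_normal_distribution)"
proof -
  have "(\<integral>\<^sup>+g. F g \<partial>std_normal_distribution) = (\<integral>\<^sup>+g. ennreal (std_normal_density g) * F g \<partial>lborel)"
    by (rule nn_integral_density) auto
  also have "\<dots> = (\<integral>\<^sup>+g. ennreal (std_normal_density g) * F (- g) \<partial>lborel)"
    by (subst nn_integral_real_affine[where c = "-1" and t = 0]) (auto simp: std_normal_density_def)
  also have "\<dots> = (\<integral>\<^sup>+g. F (- g) \<partial>std_normal_distribution)"
    by (rule nn_integral_density[symmetric]) auto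
  finally show ?thesis ..
qed

text \<open>Averaging over \<open>g\<close> and \<open>- g\<close>, which have the same law,
  replaces a pointwise bound by a bound on the sum of the two values; the odd part of the integrand
  can then be controlled by its sign.\<close>

lemma nn_integral_std_normal_le_symmetrized:
  assumes [measurable]: "F \<in> borel_measurable borel" "B \<in> borel_measurable borel"
    and le: "\<And>g. F g + F (- g) \<le> 2 * B g"
  shows "(\<integral>\<^sup>+g. F g \<partial>std_normal_distribution) \<le> (\<integral>\<^sup>+g. B g \<partial>std_normal_distribution)"
proof -
  have "2 * (\<integral>\<^sup>+g. F g \<partial>std_normal_distribution)
      = (\<integral>\<^sup>+g. F g \<partial>std_normal_distribution) + (\<integral>\<^sup>+g. F (- g) \<partial>std_normal_distribution)"
    by (simp add: nn_integral_std_normal_uminus mult_2)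
  also have "\<dots> = (\<integral>\<^sup>+g. F g + F (- g) \<partial>std_normal_distribution)"
    by (rule nn_integral_add[symmetric]) auto
  also have "\<dots> \<le> (\<integral>\<^sup>+g. 2 * B g \<partial>std_normal_distribution)"
    by (intro nn_integral_mono le)
  also have "\<dots> = 2 * (\<integral>\<^sup>+g. B g \<partial>std_normal_distribution)"
    by (rule nn_integral_cmult) auto
  finally show ?thesis
    by (subst (asm) ennreal_mult_le_mult_iff) auto
qed

lemma std_normal_second_moment:
  assumes "A \<ge> 0" "B \<ge> 0"
  shows "(\<integral>\<^sup>+g. ennreal (A + B * g\<^sup>2) \<partial>std_normal_distribution) = ennreal (A + B)"
proof -
  interpret real_distribution std_normal_distribution by (rule real_dist_normal_dist)
  have i: "integrable std_normal_distribution (\<lambda>g. g\<^sup>2)"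
    using std_normal_distribution_even_moments(2)[of 1] by simp
  have "(LINT g|std_normal_distribution. g\<^sup>2) = 1"
    using std_normal_distribution_even_moments(1)[of 1] by simp
  then have "(LINT g|std_normal_distribution. A + B * g\<^sup>2) = A + B"
    using i prob_space by simp
  moreover have "(\<integral>\<^sup>+g. ennreal (A + B * g\<^sup>2) \<partial>std_normal_distribution)
      = ennreal (LINT g|std_normal_distribution. A + B * g\<^sup>2)"
    by (rule nn_integral_eq_integral) (use i assms in auto)
  ultimately show ?thesis by simp
qed

locale separable_mala =
  fixes d :: nat and \<phi> \<phi>' :: "nat \<Rightarrow> real \<Rightarrow> real" and h :: real
  assumes \<phi>_meas [measurable]: "\<And>i. \<phi> i \<in> borel_measurable borel" "\<And>i. \<phi>' i \<in> borel_measurable borel"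
    and h: "h > 0"
begin

definition sep_f :: "(nat \<Rightarrow> real) \<Rightarrow> real" where
  "sep_f x = (\<Sum>i<d. \<phi> i (x i))"

definition sep_G :: "(nat \<Rightarrow> real) \<Rightarrow> nat \<Rightarrow> real" where
  "sep_G x = (\<lambda>i\<in>{..<d}. \<phi>' i (x i))"

sublocale mala d sep_f sep_G h
proof
  have c: "(\<lambda>x. q (x i)) \<in> borel_measurable (lebd d)"
    if "q \<in> borel_measurable borel" "i < d" for q :: "real \<Rightarrow> real" and i
    using measurable_compose[OF measurable_lebd_component[OF that(2)] that(1)] by simp
  show "sep_f \<in> borel_measurable (lebd d)"
    unfolding sep_f_def[abs_def] by (intro borel_measurable_sum c) auto
  fix i assume "i < d"
  then show "(\<lambda>x. sep_G x i) \<in> borel_measurable (lebd d)"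
    using c[of "\<phi>' i" i] by (simp add: sep_G_def)
qed

lemma acc_eq: "acc x y = min 1 (exp (\<Sum>i<d. mh_log_ratio (\<phi> i) (\<phi>' i) h (x i) (y i)))"
  by (simp add: mala_acc_def vnorm_power2 sep_f_def sep_G_def mh_log_ratio_def
      sum.distrib sum_subtractf sum_distrib_left right_diff_distrib)

text \<open>\<open>min 1 (exp s) \<le> exp s\<close> turns the joint acceptance probability into a
  product over coordinates, so that independent noise and the product form of the start factorise
  the integral. Normalising constants may be put into \<open>r\<close>.\<close>

lemma mean_total_acc_le:
  assumes r [measurable]: "\<And>i. r i \<in> borel_measurable borel"
  shows "(\<integral>\<^sup>+x. total_acc x \<partial>density (lebd d) (\<lambda>x. \<Prod>i<d. ennreal (exp (- \<phi> i (x i))) * r i (x i)))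
    \<le> (\<Prod>i<d. \<integral>\<^sup>+y. ennreal (exp (- \<phi> i y)) *
          (\<integral>\<^sup>+g. r i (y - h * \<phi>' i y + sqrt (2 * h) * g) \<partial>std_normal_distribution) \<partial>lborel)"
proof -
  interpret L: product_sigma_finite "\<lambda>_::nat. lborel :: real measure"
    by (rule product_sigma_finite.intro) (rule lborel.sigma_finite_measure_axioms)
  interpret N: prob_space std_normal_distribution by (rule prob_space_std_normal)
  interpret G: product_sigma_finite "\<lambda>_::nat. std_normal_distribution"
    by (rule product_sigma_finite.intro) (rule N.sigma_finite_measure_axioms)
  let ?l = "\<lambda>i x y. mh_log_ratio (\<phi> i) (\<phi>' i) h x y"
  let ?p = "\<lambda>i x g. x - h * \<phi>' i x + sqrt (2 * h) * g"
  let ?w = "\<lambda>i x. ennreal (exp (- \<phi> i x)) * r i x"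
  have [measurable]: "(\<lambda>(x, y). ?l i x y) \<in> borel_measurable (borel \<Otimes>\<^sub>M borel)" for i
    unfolding mh_log_ratio_def by measurable
  have meas: "(\<lambda>x. ?w i (x i)) \<in> borel_measurable (lebd d)" if "i < d" for i
    by (rule measurable_compose[OF measurable_lebd_component[OF that]]) measurable
  have [measurable]: "(\<lambda>x. \<Prod>i<d. ?w i (x i)) \<in> borel_measurable (lebd d)"
    by (intro borel_measurable_prod_ennreal meas) auto
  have "(\<integral>\<^sup>+x. total_acc x \<partial>density (lebd d) (\<lambda>x. \<Prod>i<d. ?w i (x i)))
      = (\<integral>\<^sup>+x. (\<Prod>i<d. ?w i (x i)) * total_acc x \<partial>lebd d)"
    by (rule nn_integral_density) measurable
  also have "\<dots> \<le> (\<integral>\<^sup>+x. (\<Prod>i<d. \<integral>\<^sup>+g. ?w i (x i) * ennreal (exp (?l i (x i) (?p i (x i) g))) \<partial>std_normal_distribution) \<partial>lebd d)"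
  proof (rule nn_integral_mono)
    fix x
    have "total_acc x \<le> (\<integral>\<^sup>+g. (\<Prod>i<d. ennreal (exp (?l i (x i) (?p i (x i) (g i))))) \<partial>gaussd d)"
      unfolding total_acc_def
    proof (rule nn_integral_mono)
      fix g
      have "acc x (propose x g) \<le> exp (\<Sum>i<d. ?l i (x i) (propose x g i))"
        unfolding acc_eq by simp
      also have "\<dots> = (\<Prod>i<d. exp (?l i (x i) (?p i (x i) (g i))))"
        by (simp add: exp_sum mala_prop_def sep_G_def)
      finally show "ennreal (acc x (propose x g)) \<le> (\<Prod>i<d. ennreal (exp (?l i (x i) (?p i (x i) (g i)))))"
        by (simp add: prod_ennreal ennreal_leI)
    qed
    also have "\<dots> = (\<Prod>i<d. \<integral>\<^sup>+g. ennreal (exp (?l i (x i) (?p i (x i) g))) \<partial>std_normal_distribution)"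
      unfolding gaussd_def by (rule G.product_nn_integral_prod) auto
    finally have "(\<Prod>i<d. ?w i (x i)) * total_acc x
        \<le> (\<Prod>i<d. ?w i (x i)) * (\<Prod>i<d. \<integral>\<^sup>+g. ennreal (exp (?l i (x i) (?p i (x i) g))) \<partial>std_normal_distribution)"
      by (intro mult_left_mono) auto
    then show "(\<Prod>i<d. ?w i (x i)) * total_acc x
        \<le> (\<Prod>i<d. \<integral>\<^sup>+g. ?w i (x i) * ennreal (exp (?l i (x i) (?p i (x i) g))) \<partial>std_normal_distribution)"
      by (simp add: nn_integral_cmult prod.distrib)
  qed
  also have "\<dots> = (\<Prod>i<d. \<integral>\<^sup>+x. \<integral>\<^sup>+g. ?w i x * ennreal (exp (?l i x (?p i x g))) \<partial>std_normal_distribution \<partial>lborel)"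
    unfolding lebd_def by (rule L.product_nn_integral_prod) auto
  also have "\<dots> = (\<Prod>i<d. \<integral>\<^sup>+y. ennreal (exp (- \<phi> i y)) *
          (\<integral>\<^sup>+g. r i (y - h * \<phi>' i y + sqrt (2 * h) * g) \<partial>std_normal_distribution) \<partial>lborel)"
    by (intro prod.cong refl mean_mh_ratio_eq h) auto
  finally show ?thesis .
qed

text \<open>In a standard Gaussian coordinate the acceptance probability is decreasing in the square of the
  proposed value, so filtering is negatively correlated with the linear part of the increment of \<open>x\<^sub>0\<^sup>2\<close>.\<close>

lemma gaussian_coordinate_drift:
  assumes d: "0 < d" and \<phi>0: "\<And>x. \<phi> 0 x = x\<^sup>2 / 2" "\<And>x. \<phi>' 0 x = x" and h2: "h \<le> 2" and x: "x \<in> Rd d"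
  shows "(\<integral>\<^sup>+y. ennreal ((y 0)\<^sup>2) \<partial>mala_kernel d sep_f sep_G h x) \<le> ennreal ((x 0)\<^sup>2) + ennreal (2 * h)"
proof -
  interpret N: prob_space std_normal_distribution by (rule prob_space_std_normal)
  interpret G: product_sigma_finite "\<lambda>_::nat. std_normal_distribution"
    by (rule product_sigma_finite.intro) (rule N.sigma_finite_measure_axioms)
  have I: "{..<d} = insert 0 {1..<d}" using d by auto
  define F where "F = (\<lambda>g. ennreal (acc x (propose x g)) * ennreal ((propose x g 0)\<^sup>2)
      + ennreal (1 - acc x (propose x g)) * ennreal ((x 0)\<^sup>2))"
  note [measurable] = x measurable_lebd_component[OF d]
  have [measurable]: "(\<lambda>g. propose x g 0) \<in> borel_measurable (gaussd d)"
    using measurable_compose[OF propose_measurable'[OF x] measurable_lebd_component[OF d]] by simp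
  have F_meas: "F \<in> borel_measurable (gaussd d)" unfolding F_def by measurable
  have "(\<integral>\<^sup>+y. ennreal ((y 0)\<^sup>2) \<partial>mala_kernel d sep_f sep_G h x) = (\<integral>\<^sup>+g. F g \<partial>gaussd d)"
    unfolding F_def by (rule nn_integral_kernel[OF x]) measurable
  also have "\<dots> = (\<integral>\<^sup>+g. \<integral>\<^sup>+t. F (g(0 := t)) \<partial>std_normal_distribution \<partial>PiM {1..<d} (\<lambda>_. std_normal_distribution))"
    unfolding gaussd_def I by (rule G.product_nn_integral_insert) (use F_meas in \<open>auto simp: gaussd_def I\<close>)
  \<comment> \<open>The noise of all other coordinates is frozen; the bound holds for each of their
    values.\<close>
  also have "\<dots> \<le> (\<integral>\<^sup>+g. ennreal ((x 0)\<^sup>2 + 2 * h) \<partial>PiM {1..<d} (\<lambda>_. std_normal_distribution))"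
  proof (rule nn_integral_mono)
    fix g assume g: "g \<in> space (PiM {1..<d} (\<lambda>_. std_normal_distribution))"
    have upd: "(\<lambda>t. g(0 := t)) \<in> measurable borel (gaussd d)"
      using measurable_component_update[OF g, of 0] unfolding gaussd_def I by simp
    have "(\<integral>\<^sup>+t. F (g(0 := t)) \<partial>std_normal_distribution) \<le> (\<integral>\<^sup>+t. ennreal ((x 0)\<^sup>2 + 2 * h * t\<^sup>2) \<partial>std_normal_distribution)"
    proof (rule nn_integral_std_normal_le_symmetrized)
      show "(\<lambda>t. F (g(0 := t))) \<in> borel_measurable borel"
        using measurable_compose[OF upd F_meas] by simp
      fix t
      define a where "a = (\<lambda>t. acc x (propose x (g(0 := t))))"
      define y where "y = (\<lambda>t. (1 - h) * x 0 + sqrt (2 * h) * t)"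
      have a01: "0 \<le> a t" "a t \<le> 1" for t by (auto simp: a_def acc_bounds)
      have y: "propose x (g(0 := t)) 0 = y t" for t
        using d by (simp add: mala_prop_def sep_G_def \<phi>0 y_def algebra_simps)
      have F_eq: "F (g(0 := t)) = ennreal ((x 0)\<^sup>2 + a t * ((y t)\<^sup>2 - (x 0)\<^sup>2))" for t
      proof -
        have "F (g(0 := t)) = ennreal (a t * (y t)\<^sup>2 + (1 - a t) * (x 0)\<^sup>2)"
          unfolding F_def y by (simp add: a_def acc_bounds ennreal_mult')
        then show ?thesis by (simp add: algebra_simps)
      qed
      have nonneg: "0 \<le> (x 0)\<^sup>2 + a t * ((y t)\<^sup>2 - (x 0)\<^sup>2)" for t
      proof -
        have "0 \<le> a t * (y t)\<^sup>2 + (1 - a t) * (x 0)\<^sup>2" using a01[of t] by (intro add_nonneg_nonneg mult_nonneg_nonneg) auto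
        then show ?thesis by (simp add: algebra_simps)
      qed
      have mono: "a s \<le> a t" if le: "(y t)\<^sup>2 \<le> (y s)\<^sup>2" for s t
      proof -
        let ?L = "\<lambda>t i. mh_log_ratio (\<phi> i) (\<phi>' i) h (x i) (propose x (g(0 := t)) i)"
        \<comment> \<open>For the standard Gaussian the difference of potentials cancels against the
          cross terms of the two squares; only the drift terms of order \<open>h\<close>
          survive.\<close>
        have 0: "mh_log_ratio (\<phi> 0) (\<phi>' 0) h u v = h / 4 * (u\<^sup>2 - v\<^sup>2)" for u v
          unfolding mh_log_ratio_def \<phi>0 using h by (simp add: field_simps power2_eq_square)
        have "(\<Sum>i<d. ?L s i) \<le> (\<Sum>i<d. ?L t i)"
        proof (rule sum_mono)
          fix i assume "i \<in> {..<d}"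
          show "?L s i \<le> ?L t i"
          proof (cases "i = 0")
            case True
            show ?thesis unfolding True 0 y using le h by (intro mult_left_mono) auto
          next
            case False
            then have "propose x (g(0 := s)) i = propose x (g(0 := t)) i" by (simp add: mala_prop_def)
            then show ?thesis by simp
          qed
        qed
        then show ?thesis unfolding a_def acc_eq by (auto simp: min_def)
      qed
      define c where "c = (1 - h) * x 0 * sqrt (2 * h)"
      \<comment> \<open>Split into a part even in \<open>t\<close>, whose term in \<open>x 0\<close>
        is nonpositive for \<open>h \<le> 2\<close>, and the odd part
        \<open>2 * (c * t)\<close>.\<close>
      have ysq: "(y t)\<^sup>2 - (x 0)\<^sup>2 = ((h - 2) * h * (x 0)\<^sup>2 + 2 * h * t\<^sup>2) + 2 * (c * t)" for t
        using h by (simp add: y_def c_def power2_sum power_mult_distrib) (simp add: algebra_simps power2_eq_square)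
      \<comment> \<open>The sign of \<open>c * t\<close> tells which of the two proposals has the
        larger square and is therefore accepted no more often than the other.\<close>
      have cross: "(c * t) * (a t - a (- t)) \<le> 0"
      proof (cases "c * t \<ge> 0")
        case True
        then have "(y (- t))\<^sup>2 \<le> (y t)\<^sup>2" using ysq[of t] ysq[of "- t"] by simp
        from mono[OF this] True show ?thesis by (simp add: mult_nonneg_nonpos)
      next
        case False
        then have "(y t)\<^sup>2 \<le> (y (- t))\<^sup>2" using ysq[of t] ysq[of "- t"] by simp
        from mono[OF this] False show ?thesis by (simp add: mult_nonpos_nonneg)
      qed
      have neg: "(h - 2) * h * (x 0)\<^sup>2 \<le> 0" using h h2 by (simp add: mult_nonpos_nonneg)
      have q: "a t * ((h - 2) * h * (x 0)\<^sup>2 + 2 * h * t\<^sup>2) \<le> 2 * h * t\<^sup>2" for t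
      proof -
        have "a t * ((h - 2) * h * (x 0)\<^sup>2 + 2 * h * t\<^sup>2) \<le> a t * (2 * h * t\<^sup>2)"
          by (rule mult_left_mono) (use neg a01 in auto)
        also have "\<dots> \<le> 1 * (2 * h * t\<^sup>2)"
          using h a01 by (intro mult_right_mono) auto
        finally show ?thesis by simp
      qed
      have "a t * ((y t)\<^sup>2 - (x 0)\<^sup>2) + a (- t) * ((y (- t))\<^sup>2 - (x 0)\<^sup>2)
          = a t * ((h - 2) * h * (x 0)\<^sup>2 + 2 * h * t\<^sup>2)
            + a (- t) * ((h - 2) * h * (x 0)\<^sup>2 + 2 * h * (- t)\<^sup>2) + 2 * ((c * t) * (a t - a (- t)))"
        unfolding ysq by (simp add: algebra_simps)
      also have "\<dots> \<le> 2 * h * t\<^sup>2 + 2 * h * (- t)\<^sup>2"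
        using q[of t] q[of "- t"] cross by linarith
      finally have "((x 0)\<^sup>2 + a t * ((y t)\<^sup>2 - (x 0)\<^sup>2)) + ((x 0)\<^sup>2 + a (- t) * ((y (- t))\<^sup>2 - (x 0)\<^sup>2))
          \<le> 2 * ((x 0)\<^sup>2 + 2 * h * t\<^sup>2)" by simp
      then have "ennreal (((x 0)\<^sup>2 + a t * ((y t)\<^sup>2 - (x 0)\<^sup>2)) + ((x 0)\<^sup>2 + a (- t) * ((y (- t))\<^sup>2 - (x 0)\<^sup>2)))
          \<le> ennreal (2 * ((x 0)\<^sup>2 + 2 * h * t\<^sup>2))" by (rule ennreal_leI)
      then show "F (g(0 := t)) + F (g(0 := - t)) \<le> 2 * ennreal ((x 0)\<^sup>2 + 2 * h * t\<^sup>2)"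
        unfolding F_eq ennreal_plus[OF nonneg nonneg, symmetric] by (subst (asm) ennreal_mult') simp_all
    qed measurable
    also have "\<dots> = ennreal ((x 0)\<^sup>2 + 2 * h)"
      using h by (intro std_normal_second_moment) auto
    finally show "(\<integral>\<^sup>+t. F (g(0 := t)) \<partial>std_normal_distribution) \<le> ennreal ((x 0)\<^sup>2 + 2 * h)" .
  qed
  also have "\<dots> = ennreal ((x 0)\<^sup>2 + 2 * h)"
    using prob_space.emeasure_space_1[OF prob_space_PiM[of "{1..<d}" "\<lambda>_. std_normal_distribution"]]
    by (simp add: prob_space_std_normal)
  finally show ?thesis using h by (simp add: ennreal_plus)
qed

end

section \<open>The hard instance\<close>

text \<open>Stationary mass of the interval that confines the start; its inverse bounds the start
  density in coordinate 0. Being an absolute constant, it keeps \<open>d0\<close> absolute.\<close>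

definition slab_prob :: real where
  "slab_prob = measure std_normal_distribution {- (1 / 16) .. 1 / 16}"

lemma slab_prob_pos: "0 < slab_prob"
proof -
  interpret real_distribution std_normal_distribution by (rule real_dist_normal_dist)
  define c where "c = exp (- (1 / 2)) / sqrt (2 * pi)"
  have c: "0 < c" by (simp add: c_def)
  have "c \<le> std_normal_density x" if "x \<in> {- (1 / 16) .. 1 / 16}" for x
  proof -
    have "x\<^sup>2 \<le> 1" using that by (intro abs_square_le_1[THEN iffD2]) auto
    then show ?thesis by (simp add: c_def std_normal_density_def divide_right_mono)
  qed
  then have "(\<integral>\<^sup>+x. ennreal c * indicator {- (1 / 16) .. 1 / 16 :: real} x \<partial>lborel)
      \<le> (\<integral>\<^sup>+x. ennreal (std_normal_density x) * indicator {- (1 / 16) .. 1 / 16 :: real} x \<partial>lborel)"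
    by (intro nn_integral_mono) (auto simp: indicator_def intro!: ennreal_leI)
  also have "\<dots> = emeasure std_normal_distribution {- (1 / 16) .. 1 / 16}"
    by (rule emeasure_density[symmetric]) auto
  finally have "ennreal c * ennreal (1 / 8) \<le> ennreal slab_prob"
    by (simp add: nn_integral_cmult slab_prob_def emeasure_eq_measure)
  then have "c * (1 / 8) \<le> slab_prob"
    using c by (simp add: slab_prob_def ennreal_mult'[symmetric] del: mult_1_right)
  moreover have "0 < c * (1 / 8)" using c by simp
  ultimately show ?thesis by linarith
qed

lemma std_normal_quarter_le: "emeasure std_normal_distribution {- (1 / 4) .. 1 / 4} \<le> ennreal (1 / 4)"
proof -
  have "std_normal_density x \<le> 1 / 2" for x
  proof -
    have "2 \<le> sqrt (2 * pi)" using pi_ge_two by (intro real_le_rsqrt) simp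
    then have "1 / sqrt (2 * pi) \<le> 1 / 2" by (intro divide_left_mono) auto
    then have "1 / sqrt (2 * pi) * exp (- x\<^sup>2 / 2) \<le> 1 / 2 * 1" by (intro mult_mono) auto
    then show ?thesis by (simp add: std_normal_density_def)
  qed
  then have "(\<integral>\<^sup>+x. ennreal (std_normal_density x) * indicator {- (1 / 4) .. 1 / 4 :: real} x \<partial>lborel)
      \<le> (\<integral>\<^sup>+x. ennreal (1 / 2) * indicator {- (1 / 4) .. 1 / 4 :: real} x \<partial>lborel)"
    by (intro nn_integral_mono mult_right_mono ennreal_leI) auto
  also have "\<dots> = ennreal (1 / 2) * ennreal (1 / 2)" by (simp add: nn_integral_cmult)
  also have "\<dots> = ennreal (1 / 4)" by (subst ennreal_mult'[symmetric]) auto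
  finally show ?thesis by (subst emeasure_density) auto
qed

lemma prod_if_first:
  fixes c q :: real
  assumes "0 < d"
  shows "(\<Prod>i<d. if i = 0 then c else q) = c * q ^ (d - 1)"
proof -
  have "{..<d} = insert 0 {1..<d}" using assms by auto
  then have "(\<Prod>i<d. if i = 0 then c else q) = c * (\<Prod>i\<in>{1..<d}. if i = 0 then c else q)" by simp
  also have "(\<Prod>i\<in>{1..<d}. if i = 0 then c else q) = (\<Prod>i\<in>{1..<d}. q)" by (rule prod.cong) auto
  finally show ?thesis by simp
qed

lemma tv_dist_ge:
  assumes "prob_space M" "prob_space N" "A \<in> sets M"
  shows "measure M A - measure N A \<le> tv_dist M N"
proof -
  have "\<bar>measure M B - measure N B\<bar> \<le> 1" for B
    using prob_space.prob_le_1[OF assms(1), of B] prob_space.prob_le_1[OF assms(2), of B]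
      measure_nonneg[of M B] measure_nonneg[of N B] by linarith
  then have "bdd_above ((\<lambda>B. \<bar>measure M B - measure N B\<bar>) ` sets M)"
    by (intro bdd_aboveI2[where M = 1]) auto
  from cSUP_upper[OF assms(3) this] show ?thesis
    by (simp add: tv_dist_def)
qed

text \<open>The amplitude is at most a third of the condition number, which keeps the Hessian of each oscillating
  coordinate at or above \<open>\<kappa> / 6 > 1\<close>, and amplitude times \<open>h\<close> is at most 1/100, which makes the quadratic error in
  \<open>tilted_cos_gap_pointwise\<close> negligible.\<close>

locale hard_instance =
  fixes d :: nat and \<kappa> h W m :: real
  assumes d: "0 < d" and \<kappa>: "10 \<le> \<kappa>" and hpos: "h > 0" and W: "W > 0" and m: "0 \<le> m" "m \<le> 1"
    and mass: "(\<integral>\<^sup>+x. ennreal (exp (- pot (\<kappa> / 2) (min (\<kappa> / 3) (1 / (100 * h))) h x)) \<partial>lborel) = ennreal W"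
    and start_mass: "(\<integral>\<^sup>+x. ennreal (exp (- pot (\<kappa> / 2) (min (\<kappa> / 3) (1 / (100 * h))) h x)) *
      ennreal (1 + cos (x / sqrt h)) \<partial>lborel) = ennreal (W * (1 + m))"
    and step_mass: "(\<integral>\<^sup>+y. ennreal (exp (- pot (\<kappa> / 2) (min (\<kappa> / 3) (1 / (100 * h))) h y)) *
      (\<integral>\<^sup>+g. ennreal (1 + cos ((y - h * dpot (\<kappa> / 2) (min (\<kappa> / 3) (1 / (100 * h))) h y + sqrt (2 * h) * g) / sqrt h))
        \<partial>std_normal_distribution) \<partial>lborel) \<le> ennreal (W * (1 + m) * (1 - min (\<kappa> / 3) (1 / (100 * h)) * h / 80))"
begin

definition curv :: "nat \<Rightarrow> real" where "curv i = (if i = 0 then 1 else \<kappa> / 2)"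
definition amp :: "nat \<Rightarrow> real" where "amp i = (if i = 0 then 0 else min (\<kappa> / 3) (1 / (100 * h)))"
definition wt :: "nat \<Rightarrow> real" where "wt i = (if i = 0 then sqrt (2 * pi) else W)"
text \<open>Density of the start relative to the stationary marginal, with mean one under it in
  every coordinate.\<close>

definition start :: "nat \<Rightarrow> real \<Rightarrow> real" where
  "start i x = (if i = 0 then indicator {- (1 / 16) .. 1 / 16} x / slab_prob else (1 + cos (x / sqrt h)) / (1 + m))"

sublocale separable_mala d "\<lambda>i. pot (curv i) (amp i) h" "\<lambda>i. dpot (curv i) (amp i) h" h
  by unfold_locales (use hpos in auto)

section \<open>Curvature bounds and regularity of the instance\<close>

lemma curv_amp: "curv i \<ge> 0" "amp i \<ge> 0" "1 \<le> curv i - amp i" "curv i + amp i \<le> \<kappa>"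
proof -
  have "amp i \<le> \<kappa> / 3"
    by (cases "i = 0") (use \<kappa> in \<open>simp_all add: amp_def del: le_divide_eq_numeral1\<close>)
  then show "curv i \<ge> 0" "amp i \<ge> 0" "1 \<le> curv i - amp i" "curv i + amp i \<le> \<kappa>"
    using \<kappa> hpos by (auto simp: curv_def amp_def)
qed

lemma pot_0: "pot (curv 0) (amp 0) h x = x\<^sup>2 / 2" "dpot (curv 0) (amp 0) h x = x"
  by (simp_all add: pot_def dpot_def curv_def amp_def)

lemma wt_pos: "wt i > 0" using W by (simp add: wt_def)

lemma start_nonneg: "start i x \<ge> 0"
proof -
  have "0 \<le> 1 + cos (x / sqrt h)" using cos_ge_minus_one[of "x / sqrt h"] by linarith
  then show ?thesis using slab_prob_pos m by (simp add: start_def)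
qed

lemma start_measurable [measurable]: "start i \<in> borel_measurable borel"
  unfolding start_def[abs_def] by (cases "i = 0") simp_all

lemma gradient: "has_gradient d sep_f sep_G"
  unfolding sep_f_def[abs_def] sep_G_def[abs_def]
proof (rule has_gradient_separable)
  show "(pot (curv i) (amp i) h has_real_derivative dpot (curv i) (amp i) h x) (at x)" for i x
    by (rule pot_deriv[OF hpos])
  show "\<bar>dpot (curv i) (amp i) h x - dpot (curv i) (amp i) h y\<bar> \<le> \<kappa> * \<bar>x - y\<bar>" for i x y
    using pot_lipschitz(1)[OF hpos curv_amp(1,2)] mult_right_mono[OF curv_amp(4), of "\<bar>x - y\<bar>"]
    by (meson abs_ge_zero order.trans)
qed (use \<kappa> in auto)

definition sep_H :: "(nat \<Rightarrow> real) \<Rightarrow> nat \<Rightarrow> nat \<Rightarrow> real" where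
  "sep_H x = diag_mat (\<lambda>i. ddpot (curv i) (amp i) h (x i))"

lemma hessian: "has_hessian d sep_G sep_H"
  unfolding sep_G_def[abs_def] sep_H_def[abs_def]
proof (rule has_hessian_separable)
  show "(dpot (curv i) (amp i) h has_real_derivative ddpot (curv i) (amp i) h x) (at x)" for i x
    by (rule pot_deriv[OF hpos])
  show "\<bar>ddpot (curv i) (amp i) h x - ddpot (curv i) (amp i) h y\<bar> \<le> \<kappa> / sqrt h * \<bar>x - y\<bar>" for i x y
  proof -
    have "amp i / sqrt h \<le> \<kappa> / sqrt h"
      using curv_amp[of i] hpos by (intro divide_right_mono) auto
    from mult_right_mono[OF this, of "\<bar>x - y\<bar>"] show ?thesis
      using pot_lipschitz(2)[OF hpos curv_amp(1,2), of i i x y] by auto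
  qed
qed (use \<kappa> hpos in auto)

lemma hessian_bounds:
  "ip d v v \<le> ip d v (matvec d (sep_H x) v)" "ip d v (matvec d (sep_H x) v) \<le> \<kappa> * ip d v v"
proof -
  have "\<bar>amp i * cos t\<bar> \<le> amp i * 1" for i t
    unfolding abs_mult using curv_amp(2)[of i] by (intro mult_mono) auto
  then have "\<bar>amp i * cos t\<bar> \<le> amp i" for i t by simp
  then have b: "1 \<le> ddpot (curv i) (amp i) h t" "ddpot (curv i) (amp i) h t \<le> \<kappa>" for i t
    using curv_amp(3,4)[of i] by (auto simp: ddpot_def abs_le_iff intro: order.trans)
      (smt (verit, best))+
  show "ip d v v \<le> ip d v (matvec d (sep_H x) v)"
    using diag_quadratic_form_bounds(1)[of d 1 "\<lambda>i. ddpot (curv i) (amp i) h (x i)" \<kappa> v] b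
    by (simp add: sep_H_def)
  show "ip d v (matvec d (sep_H x) v) \<le> \<kappa> * ip d v v"
    using diag_quadratic_form_bounds(2)[of d 1 "\<lambda>i. ddpot (curv i) (amp i) h (x i)" \<kappa> v] b
    by (simp add: sep_H_def)
qed

section \<open>Normalisation of target and start\<close>

lemma exp_pot_0: "exp (- pot (curv 0) (amp 0) h x) = wt 0 * std_normal_density x"
  by (simp add: pot_0 wt_def std_normal_density_def)

lemma coordinate_mass: "(\<integral>\<^sup>+x. ennreal (exp (- pot (curv i) (amp i) h x)) \<partial>lborel) = ennreal (wt i)"
proof (cases "i = 0")
  case True
  interpret N: prob_space std_normal_distribution by (rule prob_space_std_normal)
  have "(\<integral>\<^sup>+x. ennreal (std_normal_density x) \<partial>lborel) = 1"
    using N.emeasure_space_1 by (simp add: emeasure_density)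
  then show ?thesis
    unfolding True exp_pot_0 by (simp add: ennreal_mult' wt_pos less_imp_le nn_integral_cmult)
next
  case False
  then show ?thesis using mass by (simp add: curv_def amp_def wt_def)
qed

lemma start_cosine:
  assumes "i \<noteq> 0"
  shows "ennreal (start i x / wt i) = ennreal (1 / (W * (1 + m))) * ennreal (1 + cos (x / sqrt h))"
proof -
  have "start i x / wt i = 1 / (W * (1 + m)) * (1 + cos (x / sqrt h))"
    using assms by (simp add: start_def wt_def mult.commute)
  moreover have "0 \<le> 1 / (W * (1 + m))" using W m by simp
  ultimately show ?thesis by (simp only: ennreal_mult')
qed

lemma coordinate_start_mass:
  "(\<integral>\<^sup>+x. ennreal (exp (- pot (curv i) (amp i) h x)) * ennreal (start i x / wt i) \<partial>lborel) = 1"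
proof (cases "i = 0")
  case True
  interpret N: prob_space std_normal_distribution by (rule prob_space_std_normal)
  have "ennreal (exp (- pot (curv 0) (amp 0) h x)) * ennreal (start 0 x / wt 0)
      = ennreal (1 / slab_prob) * (ennreal (std_normal_density x) * indicator {- (1 / 16) .. 1 / 16} x)" for x
    unfolding exp_pot_0 using wt_pos[of 0] slab_prob_pos
    by (simp add: start_def indicator_def flip: ennreal_mult')
  then have "(\<integral>\<^sup>+x. ennreal (exp (- pot (curv i) (amp i) h x)) * ennreal (start i x / wt i) \<partial>lborel)
      = ennreal (1 / slab_prob) * (\<integral>\<^sup>+x. ennreal (std_normal_density x) * indicator {- (1 / 16) .. 1 / 16} x \<partial>lborel)"
    by (simp add: True nn_integral_cmult)
  also have "(\<integral>\<^sup>+x. ennreal (std_normal_density x) * indicator {- (1 / 16) .. 1 / 16 :: real} x \<partial>lborel)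
      = emeasure std_normal_distribution {- (1 / 16) .. 1 / 16}"
    by (rule emeasure_density[symmetric]) auto
  also have "\<dots> = ennreal slab_prob" by (simp add: slab_prob_def N.emeasure_eq_measure)
  finally show ?thesis using slab_prob_pos by (simp flip: ennreal_mult')
next
  case False
  note scale = start_cosine[OF False]
  then have "(\<integral>\<^sup>+x. ennreal (exp (- pot (curv i) (amp i) h x)) * ennreal (start i x / wt i) \<partial>lborel)
      = (\<integral>\<^sup>+x. ennreal (1 / (W * (1 + m))) * (ennreal (exp (- pot (curv i) (amp i) h x)) * ennreal (1 + cos (x / sqrt h))) \<partial>lborel)"
    unfolding scale by (simp add: mult_ac)
  also have "\<dots> = ennreal (1 / (W * (1 + m))) * ennreal (W * (1 + m))"
    using start_mass False by (subst nn_integral_cmult) (auto simp: curv_def amp_def)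
  finally show ?thesis using W m by (simp flip: ennreal_mult')
qed

definition target :: "nat \<Rightarrow> real measure" where
  "target i = density lborel (\<lambda>x. ennreal (exp (- pot (curv i) (amp i) h x) / wt i))"

definition init :: "nat \<Rightarrow> real measure" where
  "init i = density lborel (\<lambda>x. ennreal (exp (- pot (curv i) (amp i) h x)) * ennreal (start i x / wt i))"

lemma prob_space_init: "prob_space (init i)"
  by (rule prob_spaceI) (simp add: init_def emeasure_density coordinate_start_mass)

lemma prob_space_target: "prob_space (target i)"
proof (rule prob_spaceI)
  have "ennreal (exp (- pot (curv i) (amp i) h x) / wt i)
      = ennreal (1 / wt i) * ennreal (exp (- pot (curv i) (amp i) h x))" for x
    using wt_pos[of i] by (simp flip: ennreal_mult')
  then have "(\<integral>\<^sup>+x. ennreal (exp (- pot (curv i) (amp i) h x) / wt i) \<partial>lborel) = ennreal (1 / wt i) * ennreal (wt i)"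
    by (simp add: nn_integral_cmult coordinate_mass)
  also have "\<dots> = 1" using wt_pos[of i] by (simp flip: ennreal_mult')
  finally show "emeasure (target i) (space (target i)) = 1"
    by (simp add: target_def emeasure_density)
qed

lemma target_0: "target 0 = std_normal_distribution"
  unfolding target_def exp_pot_0 using wt_pos[of 0] by simp

lemma partition_function: "(\<integral>\<^sup>+x. ennreal (exp (- sep_f x)) \<partial>lebd d) = ennreal (\<Prod>i<d. wt i)"
proof -
  interpret L: product_sigma_finite "\<lambda>_::nat. lborel :: real measure"
    by (rule product_sigma_finite.intro) (rule lborel.sigma_finite_measure_axioms)
  have "(\<integral>\<^sup>+x. ennreal (exp (- sep_f x)) \<partial>lebd d) = (\<integral>\<^sup>+x. (\<Prod>i<d. ennreal (exp (- pot (curv i) (amp i) h (x i)))) \<partial>lebd d)"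
    by (simp add: sep_f_def exp_sum prod_ennreal flip: sum_negf)
  also have "\<dots> = (\<Prod>i<d. ennreal (wt i))"
    unfolding lebd_def by (subst L.product_nn_integral_prod) (auto simp: coordinate_mass)
  also have "\<dots> = ennreal (\<Prod>i<d. wt i)" using wt_pos by (simp add: prod_ennreal less_imp_le)
  finally show ?thesis .
qed

lemma gibbs_density:
  "gibbs d sep_f = density (lebd d) (\<lambda>x. \<Prod>i<d. ennreal (exp (- pot (curv i) (amp i) h (x i)) / wt i))"
proof -
  have "ennreal (exp (- sep_f x)) / ennreal (\<Prod>i<d. wt i)
      = (\<Prod>i<d. ennreal (exp (- pot (curv i) (amp i) h (x i)) / wt i))" for x
  proof -
    have "ennreal (exp (- sep_f x)) / ennreal (\<Prod>i<d. wt i) = ennreal (exp (- sep_f x) / (\<Prod>i<d. wt i))"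
      using wt_pos by (intro divide_ennreal prod_pos) auto
    also have "exp (- sep_f x) / (\<Prod>i<d. wt i) = (\<Prod>i<d. exp (- pot (curv i) (amp i) h (x i)) / wt i)"
      by (simp add: sep_f_def exp_sum prod_dividef flip: sum_negf)
    also have "ennreal \<dots> = (\<Prod>i<d. ennreal (exp (- pot (curv i) (amp i) h (x i)) / wt i))"
      using wt_pos by (subst prod_ennreal) (auto simp: less_imp_le)
    finally show ?thesis .
  qed
  then show ?thesis unfolding gibbs_def partition_function by simp
qed

lemma gibbs_eq_PiM: "gibbs d sep_f = PiM {..<d} target"
  unfolding gibbs_density lebd_def target_def
proof (rule density_PiM)
  fix i
  interpret prob_space "target i" by (rule prob_space_target)
  show "sigma_finite_measure (density lborel (\<lambda>x. ennreal (exp (- pot (curv i) (amp i) h x) / wt i)))"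
    using sigma_finite_measure_axioms by (simp add: target_def)
qed (auto intro: lborel.sigma_finite_measure_axioms)

definition warm :: "(nat \<Rightarrow> real) \<Rightarrow> ennreal" where
  "warm x = (\<Prod>i<d. ennreal (start i (x i)))"

lemma component_measurable:
  "q \<in> borel_measurable borel \<Longrightarrow> i < d \<Longrightarrow> (\<lambda>x. q (x i)) \<in> borel_measurable (lebd d)"
  using measurable_compose[OF measurable_lebd_component] by blast

lemma warm_measurable [measurable]: "warm \<in> borel_measurable (lebd d)"
  unfolding warm_def[abs_def]
  by (intro borel_measurable_prod_ennreal component_measurable) auto

text \<open>An oscillating coordinate contributes at most 2 because \<open>1 + cos\<close> is at
  most 2 and \<open>m \<ge> 0\<close>; here the sign of the stationary mean of the cosine matters.
  Since 2 < e, the constant \<open>1 / slab_prob\<close> is absorbed for large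
  \<open>d\<close>.\<close>

lemma warm_le: "warm x \<le> ennreal (2 ^ (d - 1) / slab_prob)"
proof -
  have le: "start i t \<le> (if i = 0 then 1 / slab_prob else 2)" for i t
  proof (cases "i = 0")
    case False
    have "1 + cos (t / sqrt h) \<le> 2" using cos_le_one[of "t / sqrt h"] by simp
    also have "\<dots> \<le> 2 * (1 + m)" using m by simp
    finally have "1 + cos (t / sqrt h) \<le> 2 * (1 + m)" .
    then show ?thesis using False m by (simp add: start_def pos_divide_le_eq)
  qed (use slab_prob_pos in \<open>simp add: start_def indicator_def\<close>)
  have "warm x = ennreal (\<Prod>i<d. start i (x i))"
    unfolding warm_def by (rule prod_ennreal) (rule start_nonneg)
  also have "\<dots> \<le> ennreal (\<Prod>i<d. if i = 0 then 1 / slab_prob else 2)"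
    by (intro ennreal_leI prod_mono conjI le start_nonneg)
  also have "(\<Prod>i<d. if i = 0 then 1 / slab_prob else 2) = 2 ^ (d - 1) / slab_prob"
    unfolding prod_if_first[OF d] by simp
  finally show ?thesis .
qed

lemma start_density:
  "density (gibbs d sep_f) warm = density (lebd d)
     (\<lambda>x. \<Prod>i<d. ennreal (exp (- pot (curv i) (amp i) h (x i))) * ennreal (start i (x i) / wt i))"
proof -
  have "(\<Prod>i<d. ennreal (exp (- pot (curv i) (amp i) h (x i)) / wt i)) * warm x
     = (\<Prod>i<d. ennreal (exp (- pot (curv i) (amp i) h (x i))) * ennreal (start i (x i) / wt i))" for x
    unfolding warm_def prod.distrib[symmetric] using wt_pos start_nonneg
    by (intro prod.cong refl) (simp add: less_imp_le flip: ennreal_mult')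
  moreover have "(\<lambda>x. \<Prod>i<d. ennreal (exp (- pot (curv i) (amp i) h (x i)) / wt i)) \<in> borel_measurable (lebd d)"
    by (intro borel_measurable_prod_ennreal component_measurable) auto
  ultimately show ?thesis
    unfolding gibbs_density by (subst density_density_eq) auto
qed

lemma start_eq_PiM: "density (gibbs d sep_f) warm = PiM {..<d} init"
  unfolding start_density lebd_def init_def
proof (rule density_PiM)
  fix i
  interpret prob_space "init i" by (rule prob_space_init)
  show "sigma_finite_measure (density lborel (\<lambda>x. ennreal (exp (- pot (curv i) (amp i) h x)) * ennreal (start i x / wt i)))"
    using sigma_finite_measure_axioms by (simp add: init_def)
qed (auto intro: lborel.sigma_finite_measure_axioms)

lemma prob_space_start: "prob_space (density (gibbs d sep_f) warm)"
  unfolding start_eq_PiM by (intro prob_space_PiM prob_space_init)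

lemma prob_space_gibbs: "prob_space (gibbs d sep_f)"
  unfolding gibbs_eq_PiM by (intro prob_space_PiM prob_space_target)

lemma sets_start: "sets (density (gibbs d sep_f) warm) = sets (lebd d)"
  by (simp add: gibbs_def)

section \<open>The separating event\<close>

definition slab :: "(nat \<Rightarrow> real) set" where
  "slab = {x \<in> Rd d. x 0 \<in> {- (1 / 4) .. 1 / 4}}"

lemma slab_sets [measurable]: "slab \<in> sets (lebd d)"
proof -
  note [measurable] = measurable_lebd_component[OF d]
  have "{x \<in> space (lebd d). x 0 \<in> {- (1 / 4) .. 1 / 4}} \<in> sets (lebd d)" by measurable
  then show ?thesis by (simp add: slab_def space_lebd)
qed

lemma PiM_slab:
  assumes "\<And>i. prob_space (M i)" "\<And>i. sets (M i) = sets borel"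
  shows "emeasure (PiM {..<d} M) slab = emeasure (M 0) {- (1 / 4) .. 1 / 4}"
proof -
  have sp: "space (PiM {..<d} M) = Rd d"
    using assms(2)[THEN sets_eq_imp_space_eq] by (simp add: space_PiM Rd_def)
  have "emeasure (distr (PiM {..<d} M) (M 0) (\<lambda>x. x 0)) {- (1 / 4) .. 1 / 4}
      = emeasure (PiM {..<d} M) ((\<lambda>x. x 0) -` {- (1 / 4) .. 1 / 4} \<inter> space (PiM {..<d} M))"
    by (rule emeasure_distr) (use d assms(2) in auto)
  also have "(\<lambda>x. x 0) -` {- (1 / 4) .. 1 / 4} \<inter> space (PiM {..<d} M) = slab"
    by (auto simp: sp slab_def)
  finally show ?thesis using distr_PiM_component[of "{..<d}" M 0] assms(1) d by simp
qed

lemma gibbs_slab: "measure (gibbs d sep_f) slab \<le> 1 / 4"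
proof -
  interpret prob_space "gibbs d sep_f" by (rule prob_space_gibbs)
  have "emeasure (gibbs d sep_f) slab \<le> ennreal (1 / 4)"
    unfolding gibbs_eq_PiM using PiM_slab[of target] prob_space_target std_normal_quarter_le
    by (simp add: target_def target_0[unfolded target_def])
  then show ?thesis by (simp add: emeasure_eq_measure)
qed

lemma start_slab: "emeasure (density (gibbs d sep_f) warm) slab = 1"
proof -
  have "emeasure (init 0) {- (1 / 4) .. 1 / 4} = (\<integral>\<^sup>+x. ennreal (exp (- pot (curv 0) (amp 0) h x)) * ennreal (start 0 x / wt 0) * indicator {- (1 / 4) .. 1 / 4} x \<partial>lborel)"
    unfolding init_def by (rule emeasure_density) auto
  also have "\<dots> = (\<integral>\<^sup>+x. ennreal (exp (- pot (curv 0) (amp 0) h x)) * ennreal (start 0 x / wt 0) \<partial>lborel)"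
    by (intro nn_integral_cong) (auto simp: start_def indicator_def)
  finally have "emeasure (init 0) {- (1 / 4) .. 1 / 4} = 1" by (simp add: coordinate_start_mass)
  then show ?thesis
    unfolding start_eq_PiM using PiM_slab[of init] prob_space_init by (simp add: init_def)
qed

lemma start_second_moment: "(\<integral>\<^sup>+x. ennreal ((x 0)\<^sup>2) \<partial>density (gibbs d sep_f) warm) \<le> ennreal (1 / 256)"
proof -
  have "(\<integral>\<^sup>+x. ennreal ((x 0)\<^sup>2) \<partial>density (gibbs d sep_f) warm)
      = (\<integral>\<^sup>+t. ennreal (t\<^sup>2) \<partial>distr (PiM {..<d} init) (init 0) (\<lambda>x. x 0))"
    unfolding start_eq_PiM 
    by (rule nn_integral_distr[symmetric, OF measurable_component_singleton]) (use d in \<open>auto simp: init_def\<close>)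
  also have "\<dots> = (\<integral>\<^sup>+t. ennreal (t\<^sup>2) \<partial>init 0)"
    using distr_PiM_component[of "{..<d}" init 0] prob_space_init d by simp
  also have "\<dots> = (\<integral>\<^sup>+t. ennreal (exp (- pot (curv 0) (amp 0) h t)) * ennreal (start 0 t / wt 0) * ennreal (t\<^sup>2) \<partial>lborel)"
    unfolding init_def by (rule nn_integral_density) auto
  also have "\<dots> \<le> (\<integral>\<^sup>+t. ennreal (exp (- pot (curv 0) (amp 0) h t)) * ennreal (start 0 t / wt 0) * ennreal (1 / 256) \<partial>lborel)"
  proof (rule nn_integral_mono)
    fix t :: real
    show "ennreal (exp (- pot (curv 0) (amp 0) h t)) * ennreal (start 0 t / wt 0) * ennreal (t\<^sup>2)
      \<le> ennreal (exp (- pot (curv 0) (amp 0) h t)) * ennreal (start 0 t / wt 0) * ennreal (1 / 256)"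
    proof (cases "t \<in> {- (1 / 16) .. 1 / 16}")
      case True
      then have "\<bar>t\<bar>\<^sup>2 \<le> (1 / 16)\<^sup>2" by (intro power_mono) auto
      then show ?thesis by (intro mult_left_mono ennreal_leI) (auto simp: power2_eq_square)
    qed (simp add: start_def)
  qed
  also have "\<dots> = ennreal (1 / 256)"
    by (subst nn_integral_multc) (auto simp: coordinate_start_mass)
  finally show ?thesis .
qed

text \<open>The slab is four times as wide as the initial interval, which leaves room for the
  spread: after \<open>T\<close> steps \<open>x 0\<close> has second moment at most 1/256 + 1/500 <
  6/1000, and Markov's inequality at level 1/16 leaves at most 96/1000 outside the slab.\<close>

lemma law_slab_small_step:
  assumes h2: "h \<le> 2" and T: "real T * h \<le> 1 / 1000"
  shows "measure (law (density (gibbs d sep_f) warm) T) slab \<ge> 9 / 10"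
proof -
  let ?\<mu> = "density (gibbs d sep_f) warm"
  interpret P: prob_space "law ?\<mu> T" by (rule prob_space_law[OF prob_space_start sets_start])
  have space: "space (law ?\<mu> T) = Rd d" by (rule space_law[OF prob_space_start sets_start])
  have sets: "sets (law ?\<mu> T) = sets (lebd d)" by (rule sets_law[OF prob_space_start sets_start])
  note [measurable] = measurable_lebd_component[OF d]
  have q: "(\<lambda>x. ennreal ((x 0)\<^sup>2)) \<in> borel_measurable (lebd d)" by measurable
  then have q' [measurable]: "(\<lambda>x. ennreal ((x 0)\<^sup>2)) \<in> borel_measurable (law ?\<mu> T)"
    using measurable_cong_sets[OF sets refl] by blast
  have "(\<integral>\<^sup>+x. ennreal ((x 0)\<^sup>2) \<partial>law ?\<mu> T) \<le> (\<integral>\<^sup>+x. ennreal ((x 0)\<^sup>2) \<partial>?\<mu>) + ennreal (real T * (2 * h))"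
    by (rule nn_integral_law_drift[OF prob_space_start sets_start q gaussian_coordinate_drift])
       (use d h2 hpos in \<open>auto simp: pot_0\<close>)
  also have "\<dots> \<le> ennreal (1 / 256) + ennreal (1 / 500)"
    using T by (intro add_mono start_second_moment ennreal_leI) auto
  also have "\<dots> \<le> ennreal (6 / 1000)"
    by (subst ennreal_plus[symmetric]) (auto intro!: ennreal_leI)
  finally have m2: "(\<integral>\<^sup>+x. ennreal ((x 0)\<^sup>2) \<partial>law ?\<mu> T) \<le> ennreal (6 / 1000)" .
  have slab: "slab \<in> sets (law ?\<mu> T)" using slab_sets sets by simp
  have "emeasure (law ?\<mu> T) (space (law ?\<mu> T) - slab)
      \<le> emeasure (law ?\<mu> T) {x \<in> space (law ?\<mu> T). 1 \<le> 16 * ennreal ((x 0)\<^sup>2)}"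
  proof (rule emeasure_mono)
    show "space (law ?\<mu> T) - slab \<subseteq> {x \<in> space (law ?\<mu> T). 1 \<le> 16 * ennreal ((x 0)\<^sup>2)}"
    proof safe
      fix x assume "x \<in> space (law ?\<mu> T)" "x \<notin> slab"
      then have "1 / 4 \<le> \<bar>x 0\<bar>" by (auto simp: slab_def space)
      from power_mono[OF this, of 2] have "1 \<le> 16 * (x 0)\<^sup>2" by (simp add: power2_eq_square)
      then have "ennreal 1 \<le> ennreal (16 * (x 0)\<^sup>2)" by (rule ennreal_leI)
      then show "1 \<le> 16 * ennreal ((x 0)\<^sup>2)" by (simp add: ennreal_mult')
    qed
  qed measurable
  also have "\<dots> \<le> 16 * (\<integral>\<^sup>+x. ennreal ((x 0)\<^sup>2) * indicator (space (law ?\<mu> T)) x \<partial>law ?\<mu> T)"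
    by (rule nn_integral_Markov_inequality) measurable
  also have "\<dots> = 16 * (\<integral>\<^sup>+x. ennreal ((x 0)\<^sup>2) \<partial>law ?\<mu> T)"
    by (intro arg_cong2[where f = "(*)"] refl nn_integral_cong) auto
  also have "\<dots> \<le> ennreal 16 * ennreal (6 / 1000)" using m2 by (intro mult_mono) auto
  also have "\<dots> \<le> ennreal (1 / 10)" by (subst ennreal_mult'[symmetric]) (auto intro!: ennreal_leI)
  finally have "measure (law ?\<mu> T) (space (law ?\<mu> T) - slab) \<le> 1 / 10"
    by (simp add: P.emeasure_eq_measure)
  then show ?thesis using P.prob_compl[OF slab] by simp
qed

text \<open>Coordinate 0 gets only the trivial bound \<open>1 / slab_prob\<close>, a constant; all
  decay comes from the other \<open>d - 1\<close> coordinates, whose common amplitude is written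
  \<open>amp 1\<close>.\<close>

lemma mean_acceptance_le:
  "(\<integral>\<^sup>+x. total_acc x \<partial>density (gibbs d sep_f) warm)
    \<le> ennreal (1 / slab_prob * (1 - amp 1 * h / 80) ^ (d - 1))"
proof -
  have q0: "0 \<le> 1 - amp 1 * h / 80"
    using hpos by (auto simp: amp_def min_def field_simps)
  let ?I = "\<lambda>i. \<integral>\<^sup>+y. ennreal (exp (- pot (curv i) (amp i) h y)) *
      (\<integral>\<^sup>+g. ennreal (start i (y - h * dpot (curv i) (amp i) h y + sqrt (2 * h) * g) / wt i) \<partial>std_normal_distribution) \<partial>lborel"
  have I: "?I i \<le> ennreal (if i = 0 then 1 / slab_prob else 1 - amp 1 * h / 80)" for i
  proof (cases "i = 0")
    case True
    interpret N: prob_space std_normal_distribution by (rule prob_space_std_normal)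
    have "(\<integral>\<^sup>+g. ennreal (start 0 (p g) / wt 0) \<partial>std_normal_distribution) \<le> ennreal (1 / slab_prob / wt 0)" for p
    proof -
      have "(\<integral>\<^sup>+g. ennreal (start 0 (p g) / wt 0) \<partial>std_normal_distribution) \<le> (\<integral>\<^sup>+g. ennreal (1 / slab_prob / wt 0) \<partial>std_normal_distribution)"
        using slab_prob_pos wt_pos[of 0]
        by (intro nn_integral_mono ennreal_leI divide_right_mono) (auto simp: start_def indicator_def)
      then show ?thesis using N.emeasure_space_1 by simp
    qed
    then have "?I 0 \<le> (\<integral>\<^sup>+y. ennreal (exp (- pot (curv 0) (amp 0) h y)) * ennreal (1 / slab_prob / wt 0) \<partial>lborel)"
      by (intro nn_integral_mono mult_left_mono) auto
    also have "\<dots> = ennreal (wt 0) * ennreal (1 / slab_prob / wt 0)"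
      by (subst nn_integral_multc) (auto simp: coordinate_mass)
    also have "\<dots> = ennreal (1 / slab_prob)"
      using wt_pos[of 0] slab_prob_pos by (simp flip: ennreal_mult')
    finally show ?thesis by (simp add: True)
  next
    case False
    interpret N: prob_space std_normal_distribution by (rule prob_space_std_normal)
    note [measurable] = pot_measurable[of "curv i" "amp i" h]
    let ?c = "1 / (W * (1 + m))"
    note c = start_cosine[OF False]
    have "?I i = (\<integral>\<^sup>+y. ennreal ?c * (ennreal (exp (- pot (curv i) (amp i) h y)) *
      (\<integral>\<^sup>+g. ennreal (1 + cos ((y - h * dpot (curv i) (amp i) h y + sqrt (2 * h) * g) / sqrt h)) \<partial>std_normal_distribution)) \<partial>lborel)"
      unfolding c by (subst nn_integral_cmult) (auto simp: mult_ac)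
    also have "\<dots> = ennreal ?c * (\<integral>\<^sup>+y. ennreal (exp (- pot (curv i) (amp i) h y)) *
      (\<integral>\<^sup>+g. ennreal (1 + cos ((y - h * dpot (curv i) (amp i) h y + sqrt (2 * h) * g) / sqrt h)) \<partial>std_normal_distribution) \<partial>lborel)"
      by (rule nn_integral_cmult) measurable
    also have "\<dots> \<le> ennreal ?c * ennreal (W * (1 + m) * (1 - amp 1 * h / 80))"
      using step_mass False by (intro mult_left_mono) (auto simp: curv_def amp_def)
    also have "\<dots> = ennreal (1 - amp 1 * h / 80)"
      using W m q0 by (simp flip: ennreal_mult')
    finally show ?thesis using False by simp
  qed
  have "(\<integral>\<^sup>+x. total_acc x \<partial>density (gibbs d sep_f) warm) \<le> (\<Prod>i<d. ?I i)"
    unfolding start_density by (rule mean_total_acc_le) measurable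
  also have "\<dots> \<le> (\<Prod>i<d. ennreal (if i = 0 then 1 / slab_prob else 1 - amp 1 * h / 80))"
    by (intro prod_mono_ennreal I)
  also have "\<dots> = ennreal (\<Prod>i<d. if i = 0 then 1 / slab_prob else 1 - amp 1 * h / 80)"
    using slab_prob_pos q0 by (intro prod_ennreal) auto
  also have "(\<Prod>i<d. if i = 0 then 1 / slab_prob else 1 - amp 1 * h / 80)
      = 1 / slab_prob * (1 - amp 1 * h / 80) ^ (d - 1)"
    by (rule prod_if_first[OF d])
  finally show ?thesis .
qed

lemma law_slab_large_step:
  assumes T: "real T * (1 / slab_prob * (1 - amp 1 * h / 80) ^ (d - 1)) \<le> 1 / 10"
  shows "measure (law (density (gibbs d sep_f) warm) T) slab \<ge> 9 / 10"
proof -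
  have "0 \<le> 1 / slab_prob * (1 - amp 1 * h / 80) ^ (d - 1)"
    using hpos slab_prob_pos by (intro mult_nonneg_nonneg zero_le_power) (auto simp: amp_def min_def field_simps)
  from law_ge_stay[OF prob_space_start sets_start slab_sets start_slab mean_acceptance_le this, of T]
  show ?thesis using T by linarith
qed

lemma tv_dist_lower:
  assumes "measure (law (density (gibbs d sep_f) warm) T) slab \<ge> 9 / 10"
  shows "tv_dist (law (density (gibbs d sep_f) warm) T) (gibbs d sep_f) > 1 / exp 1"
proof -
  let ?\<mu> = "density (gibbs d sep_f) warm"
  have "measure (law ?\<mu> T) slab - measure (gibbs d sep_f) slab \<le> tv_dist (law ?\<mu> T) (gibbs d sep_f)"
    by (rule tv_dist_ge[OF prob_space_law[OF prob_space_start sets_start] prob_space_gibbs])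
       (simp add: sets_law[OF prob_space_start sets_start] slab_sets)
  \<comment> \<open>The slab has mass at least 9/10 under the law and at most 1/4 under the target;
    the difference 13/20 exceeds 2/5.\<close>
  moreover have "1 / exp 1 \<le> (2 / 5 :: real)"
    using exp_minus_1_bounds(2) by (simp add: exp_minus field_simps)
  ultimately show ?thesis using assms gibbs_slab by linarith
qed

end

section \<open>Choice of parameters and large dimension\<close>

lemma hard_instance_exists:
  assumes "0 < d" "10 \<le> \<kappa>" "h > 0"
  obtains W m where "hard_instance d \<kappa> h W m"
proof -
  have "min (\<kappa> / 3) (1 / (100 * h)) * h \<le> 1 / (100 * h) * h" using assms by (intro mult_right_mono) auto
  then have "min (\<kappa> / 3) (1 / (100 * h)) * h \<le> 1 / 100" using assms by simp
  note bh = this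
  show thesis
  proof (rule cos_coordinate[OF _ assms(3) _ bh, of "\<kappa> / 2"])
    fix W m
    assume "W > 0" "0 \<le> m" "m \<le> 1"
      "(\<integral>\<^sup>+x. ennreal (exp (- pot (\<kappa> / 2) (min (\<kappa> / 3) (1 / (100 * h))) h x)) \<partial>lborel) = ennreal W"
      "(\<integral>\<^sup>+x. ennreal (exp (- pot (\<kappa> / 2) (min (\<kappa> / 3) (1 / (100 * h))) h x)) *
        ennreal (1 + cos (x / sqrt h)) \<partial>lborel) = ennreal (W * (1 + m))"
      "(\<integral>\<^sup>+y. ennreal (exp (- pot (\<kappa> / 2) (min (\<kappa> / 3) (1 / (100 * h))) h y)) *
        (\<integral>\<^sup>+g. ennreal (1 + cos ((y - h * dpot (\<kappa> / 2) (min (\<kappa> / 3) (1 / (100 * h))) h y + sqrt (2 * h) * g) / sqrt h))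
          \<partial>std_normal_distribution) \<partial>lborel) \<le> ennreal (W * (1 + m) * (1 - min (\<kappa> / 3) (1 / (100 * h)) * h / 80))"
    then show thesis by (intro that[of W m] hard_instance.intro assms)
  qed (use assms in auto)
qed

text \<open>In the first tail bound the exponent behaves like \<open>(ln d)\<^sup>2 / 240\<close>;
  the squared logarithm outweighs \<open>5 * ln d\<close> whatever the constants are. The warm-start
  bound holds because 2 < e. With \<open>p\<close> a fixed number, the threshold on \<open>d\<close>
  is absolute.\<close>

lemma eventually_dimension_bounds:
  fixes p :: real
  assumes p: "p > 0"
  shows "\<forall>\<^sub>F d :: nat in sequentially. 2 \<le> d \<and> 1 \<le> ln (real d) \<and> (ln (real d))\<^sup>2 \<le> 20 * real d \<and>
    2 ^ (d - 1) / p \<le> exp (real d) \<and>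
    real d ^ 5 * (1 / p * exp (- ((real d - 1) / 80 * ((ln (real d))\<^sup>2 / (3 * real d))))) \<le> 1 / 10 \<and>
    real d ^ 5 * (1 / p * exp (- ((real d - 1) / 80 * (1 / 100)))) \<le> 1 / 10"
proof -
  have 1: "\<forall>\<^sub>F d :: nat in sequentially. 2 \<le> d" by (rule eventually_ge_at_top)
  have 2: "\<forall>\<^sub>F d :: nat in sequentially. 1 \<le> ln (real d)" by real_asymp
  have 3: "\<forall>\<^sub>F d :: nat in sequentially. (ln (real d))\<^sup>2 \<le> 20 * real d" by real_asymp
  have "((\<lambda>d. (2 * exp (-1)) ^ d) \<longlongrightarrow> (0 :: real)) sequentially"
    using exp_minus_1_bounds by (intro LIMSEQ_realpow_zero) auto
  then have "((\<lambda>d. 2 ^ d * exp (- real d)) \<longlongrightarrow> (0 :: real)) sequentially"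
    by (simp add: power_mult_distrib flip: exp_of_nat_mult)
  from order_tendstoD(2)[OF this p]
  have 4: "\<forall>\<^sub>F d :: nat in sequentially. 2 ^ d * exp (- real d) < p" .
  have "((\<lambda>d :: nat. real d ^ 5 * exp (- ((real d - 1) / 80 * ((ln (real d))\<^sup>2 / (3 * real d))))) \<longlongrightarrow> 0) sequentially"
    by real_asymp
  from order_tendstoD(2)[OF this, of "p / 10"] p
  have 5: "\<forall>\<^sub>F d :: nat in sequentially. real d ^ 5 * exp (- ((real d - 1) / 80 * ((ln (real d))\<^sup>2 / (3 * real d)))) < p / 10"
    by simp
  have "((\<lambda>d :: nat. real d ^ 5 * exp (- ((real d - 1) / 80 * (1 / 100)))) \<longlongrightarrow> 0) sequentially"
    by real_asymp
  from order_tendstoD(2)[OF this, of "p / 10"] p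
  have 6: "\<forall>\<^sub>F d :: nat in sequentially. real d ^ 5 * exp (- ((real d - 1) / 80 * (1 / 100))) < p / 10"
    by simp
  have scale: "A * (1 / p * B) \<le> 1 / 10" if "A * B < p / 10" for A B
    using that p by (simp add: field_simps)
  from 1 2 3 4 5 6 show ?thesis
  proof eventually_elim
    case (elim d)
    have "2 ^ (d - 1) \<le> (2 :: real) ^ d" by (rule power_increasing) auto
    also have "\<dots> \<le> p * exp (real d)" using elim(4) by (simp add: exp_minus field_simps)
    finally have "2 ^ (d - 1) / p \<le> exp (real d)" using p by (simp add: field_simps)
    then show ?case using elim(1-3) scale[OF elim(5)] scale[OF elim(6)] by blast
  qed
qed

theorem theorem3:
  shows "\<exists>c::real. c > 0 \<and> (\<exists>d0::nat. \<forall>d\<ge>d0. \<forall>\<kappa>::real. 10 \<le> \<kappa> \<and> \<kappa> \<le> real d ^ 4 \<longrightarrow>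
     (\<forall>h::real. h > 0 \<longrightarrow>
       (\<exists>f G H (\<rho> :: (nat \<Rightarrow> real) \<Rightarrow> ennreal).
          has_gradient d f G \<and> has_hessian d G H \<and>
          (\<forall>x\<in>Rd d. \<forall>v\<in>Rd d. ip d v v \<le> ip d v (matvec d (H x) v) \<and>
                              ip d v (matvec d (H x) v) \<le> \<kappa> * ip d v v) \<and>
          f \<in> borel_measurable (lebd d) \<and>
          (\<integral>\<^sup>+x. ennreal (exp (- f x)) \<partial>lebd d) < \<infinity> \<and>
          \<rho> \<in> borel_measurable (lebd d) \<and> (\<forall>x. \<rho> x \<le> ennreal (exp (real d))) \<and>
          prob_space (density (gibbs d f) \<rho>) \<and>
          (\<forall>T::nat. real T \<le> c * \<kappa> * real d / (ln (real d))\<^sup>2 \<longrightarrow>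
             tv_dist (mala_law d f G h (density (gibbs d f) \<rho>) T) (gibbs d f) > 1 / exp 1))))"
proof -
  from eventually_dimension_bounds[OF slab_prob_pos] obtain d0 :: nat where d0: "\<And>d. d \<ge> d0 \<Longrightarrow>
    2 \<le> d \<and> 1 \<le> ln (real d) \<and> (ln (real d))\<^sup>2 \<le> 20 * real d \<and> 2 ^ (d - 1) / slab_prob \<le> exp (real d) \<and>
    real d ^ 5 * (1 / slab_prob * exp (- ((real d - 1) / 80 * ((ln (real d))\<^sup>2 / (3 * real d))))) \<le> 1 / 10 \<and>
    real d ^ 5 * (1 / slab_prob * exp (- ((real d - 1) / 80 * (1 / 100)))) \<le> 1 / 10"
    unfolding eventually_sequentially by blast
  show ?thesis
  proof (intro exI[of _ "1 / 1000 :: real"] exI[of _ d0] conjI allI impI)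
    fix d :: nat and \<kappa> h :: real
    assume dd: "d0 \<le> d" and \<kappa>b: "10 \<le> \<kappa> \<and> \<kappa> \<le> real d ^ 4" and h0: "0 < h"
    define l where "l = (ln (real d))\<^sup>2"
    have d2: "2 \<le> d" and "1 \<le> ln (real d)" and l20: "l \<le> 20 * real d"
      and warm: "2 ^ (d - 1) / slab_prob \<le> exp (real d)"
      and rare: "real d ^ 5 * (1 / slab_prob * exp (- ((real d - 1) / 80 * (l / (3 * real d))))) \<le> 1 / 10"
        "real d ^ 5 * (1 / slab_prob * exp (- ((real d - 1) / 80 * (1 / 100)))) \<le> 1 / 10"
      using d0[OF dd] by (simp_all add: l_def)
    then have l: "1 \<le> l" unfolding l_def by (intro one_le_power) auto
    have dpos: "0 < d" using d2 by simp
    obtain W m where "hard_instance d \<kappa> h W m"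
      using hard_instance_exists[OF dpos _ h0] \<kappa>b by blast
    then interpret hard_instance d \<kappa> h W m .
    have far: "1 / exp 1 < tv_dist (law (density (gibbs d sep_f) warm) T) (gibbs d sep_f)"
      if T: "real T \<le> 1 / 1000 * \<kappa> * real d / l" for T
    \<comment> \<open>The threshold is the step size at which \<open>T * h\<close> reaches 1/1000
      for the largest admissible \<open>T\<close>.\<close>
    proof (rule tv_dist_lower, cases "h \<le> l / (\<kappa> * real d)")
      case True
      \<comment> \<open>The drift bound of coordinate 0 demands \<open>h \<le> 2\<close>, which
        comes from \<open>\<kappa> \<ge> 10\<close> and \<open>l \<le> 20 * real d\<close>.\<close>
      have "l / (\<kappa> * real d) \<le> 20 * real d / (10 * real d)"
        using l20 l \<kappa> d2 by (intro frac_le mult_mono) auto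
      then have "h \<le> 2" using True d2 by simp
      moreover have "real T * h \<le> 1 / 1000 * \<kappa> * real d / l * (l / (\<kappa> * real d))"
        using T True h l \<kappa>b by (intro mult_mono) auto
      then have "real T * h \<le> 1 / 1000" using l \<kappa> d2 by simp
      ultimately show "9 / 10 \<le> Sigma_Algebra.measure (law (density (gibbs d sep_f) warm) T) slab"
        by (rule law_slab_small_step)
    next
      case False
      define \<beta> where "\<beta> = amp 1 * h"
      have "l / real d \<le> \<kappa> * h" using False \<kappa> d2 by (simp add: field_simps)
      \<comment> \<open>\<beta> is \<kappa> h / 3 until the cap 1/100 takes over; the two cases
        correspond to the two tail bounds in \<open>rare\<close>.\<close>
      then have \<beta>: "min (l / (3 * real d)) (1 / 100) \<le> \<beta>"
        using h by (auto simp: \<beta>_def amp_def min_def field_simps)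
      have "\<beta> \<le> 1 / (100 * h) * h"
        unfolding \<beta>_def amp_def using h by (intro mult_right_mono) auto
      then have \<beta>1: "\<beta> \<le> 1" using h by simp
      have "1 - \<beta> / 80 \<le> exp (- (\<beta> / 80))" using exp_ge_add_one_self[of "- (\<beta> / 80)"] by simp
      then have "(1 - \<beta> / 80) ^ (d - 1) \<le> exp (- (\<beta> / 80)) ^ (d - 1)"
        using \<beta>1 by (intro power_mono) auto
      also have "\<dots> = exp (- ((real d - 1) / 80 * \<beta>))"
        using d2 by (simp add: exp_of_nat_mult[symmetric] of_nat_diff field_simps)
      also have "\<dots> \<le> exp (- ((real d - 1) / 80 * min (l / (3 * real d)) (1 / 100)))"
        using \<beta> d2 by (simp add: mult_left_mono)
      finally have pow: "(1 - \<beta> / 80) ^ (d - 1) \<le> exp (- ((real d - 1) / 80 * min (l / (3 * real d)) (1 / 100)))" .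
      \<comment> \<open>\<open>l \<ge> 1\<close> and \<open>\<kappa> \<le> real d ^ 4\<close> make
        the number of steps at most \<open>real d ^ 5\<close>, polynomial in the dimension.\<close>
      have "real T \<le> 1 / 1000 * \<kappa> * real d / 1"
        using T by (rule order.trans) (use l \<kappa>b in \<open>intro divide_left_mono; simp\<close>)
      also have "\<dots> \<le> 1 * real d ^ 4 * real d / 1"
        using \<kappa>b by (intro divide_right_mono mult_mono conjunct2[OF \<kappa>b]) auto
      also have "\<dots> = real d ^ 5" by (simp add: numeral_eq_Suc)
      finally have "real T * (1 / slab_prob * (1 - \<beta> / 80) ^ (d - 1))
          \<le> real d ^ 5 * (1 / slab_prob * exp (- ((real d - 1) / 80 * min (l / (3 * real d)) (1 / 100))))"
        using pow slab_prob_pos \<beta>1 by (intro mult_mono mult_nonneg_nonneg) auto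
      also have "\<dots> \<le> 1 / 10" using rare by (simp add: min_def)
      finally show "9 / 10 \<le> Sigma_Algebra.measure (law (density (gibbs d sep_f) warm) T) slab"
        unfolding \<beta>_def by (rule law_slab_large_step)
    qed
    have "warm x \<le> ennreal (exp (real d))" for x
      using warm_le ennreal_leI[OF warm] by (rule order.trans)
    moreover have "(\<integral>\<^sup>+x. ennreal (exp (- sep_f x)) \<partial>lebd d) < \<infinity>"
      unfolding partition_function by simp
    ultimately show "\<exists>f G H (\<rho> :: (nat \<Rightarrow> real) \<Rightarrow> ennreal).
          has_gradient d f G \<and> has_hessian d G H \<and>
          (\<forall>x\<in>Rd d. \<forall>v\<in>Rd d. ip d v v \<le> ip d v (matvec d (H x) v) \<and>
                              ip d v (matvec d (H x) v) \<le> \<kappa> * ip d v v) \<and>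
          f \<in> borel_measurable (lebd d) \<and>
          (\<integral>\<^sup>+x. ennreal (exp (- f x)) \<partial>lebd d) < \<infinity> \<and>
          \<rho> \<in> borel_measurable (lebd d) \<and> (\<forall>x. \<rho> x \<le> ennreal (exp (real d))) \<and>
          prob_space (density (gibbs d f) \<rho>) \<and>
          (\<forall>T::nat. real T \<le> 1 / 1000 * \<kappa> * real d / (ln (real d))\<^sup>2 \<longrightarrow>
             tv_dist (mala_law d f G h (density (gibbs d f) \<rho>) T) (gibbs d f) > 1 / exp 1)"
      using gradient hessian hessian_bounds f_meas warm_measurable prob_space_start far
      unfolding l_def by blast
  qed simp
qed

end
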